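(* Let $n,m\geq 1$ be integers and let $u\in C^2(\mathbb{R}^n;\mathbb{R}^m)$ be a non-constant solution on $\mathbb{R}^n$ of the Ginzburg–Landau system $$\Delta u=(|u|^2-1)u.$$ Then for every $x\in\mathbb{R}^n$ one has $|u(x)|<1$ and $$\frac12|\nabla u(x)|^2<\sqrt{W(u(x))}=\frac12\left(1-|u(x)|^2\right),$$ where $W(v)=\frac14(|v|^2-1)^2$ for $v\in\mathbb{R}^m$.
   Context: $|\cdot|$ is the Euclidean norm, and $|\nabla u|^2=\sum_{i=1}^n|u_{x_i}|^2$ where $u_{x_i}=\partial u/\partial x_i\in\mathbb{R}^m$. $\Delta u$ is the componentwise Laplacian. No boundedness of $u$ is assumed. *)

theory Defs
  imports "HOL-Analysis.Analysis"
begin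

definition partial_deriv :: "'n::finite \<Rightarrow> (real ^ 'n \<Rightarrow> 'b::real_normed_vector) \<Rightarrow> real ^ 'n \<Rightarrow> 'b" where
  "partial_deriv i f x = vector_derivative (\<lambda>t. f (x + t *\<^sub>R axis i 1)) (at 0)"

text \<open>\<open>vector_derivative\<close> is total, so the differentiability conjunct is what guarantees
  that the partial derivatives exist; once they are continuous, Frechet differentiability
  is no restriction.\<close>

definition C1_fun :: "(real ^ 'n::finite \<Rightarrow> 'b::real_normed_vector) \<Rightarrow> bool" where
  "C1_fun f \<longleftrightarrow> (\<forall>x. f differentiable (at x)) \<and> (\<forall>i. continuous_on UNIV (partial_deriv i f))"

definition C2_fun :: "(real ^ 'n::finite \<Rightarrow> 'b::real_normed_vector) \<Rightarrow> bool" where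
  "C2_fun f \<longleftrightarrow> C1_fun f \<and> (\<forall>i. C1_fun (partial_deriv i f))"

definition laplacian :: "(real ^ 'n::finite \<Rightarrow> real) \<Rightarrow> real ^ 'n \<Rightarrow> real" where
  "laplacian f x = (\<Sum>i\<in>UNIV. partial_deriv i (partial_deriv i f) x)"

definition vec_laplacian :: "(real ^ 'n::finite \<Rightarrow> real ^ 'm::finite) \<Rightarrow> real ^ 'n \<Rightarrow> real ^ 'm" where
  "vec_laplacian u x = (\<chi> k. laplacian (\<lambda>y. u y $ k) x)"

definition grad_norm_sq :: "(real ^ 'n::finite \<Rightarrow> real ^ 'm::finite) \<Rightarrow> real ^ 'n \<Rightarrow> real" where
  "grad_norm_sq u x = (\<Sum>i\<in>UNIV. (norm (partial_deriv i u x))\<^sup>2)"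

definition GL_potential :: "real ^ 'm::finite \<Rightarrow> real" where
  "GL_potential v = 1/4 * ((norm v)\<^sup>2 - 1)\<^sup>2"

end

theory Submission
  imports Defs
begin

text \<open>
  Write \<open>P\<^sub>a = (|\<nabla>u|\<^sup>2 - a (1 - |u|\<^sup>2)) / 2\<close>; the claim amounts to \<open>P\<^sub>1 < 0\<close>. Comparison of
  \<open>|u|\<^sup>2 - 1\<close> with a Keller--Osserman barrier gives \<open>|u| \<le> 1\<close>, and then a reflection argument
  bounds \<open>\<nabla>u\<close>. Differentiating the system,
  \<open>\<Delta>P\<^sub>a \<ge> 2 (|u|\<^sup>2 + a - 1) P\<^sub>a + a (a - 1) (1 - |u|\<^sup>2) + 2 \<Sum>\<^sub>i (u\<^sub>i \<bullet> u)\<^sup>2\<close>.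
  For \<open>a = 1 + \<epsilon>\<close> this is a coercive inequality \<open>\<Delta>P\<^sub>a \<ge> 2 \<epsilon> P\<^sub>a\<close> where \<open>P\<^sub>a > 0\<close>, so the bounded
  function \<open>P\<^sub>a\<close> is nonpositive, and \<open>\<epsilon> \<rightarrow> 0\<close> gives \<open>P\<^sub>1 \<le> 0\<close>. By the strong maximum principle
  \<open>P\<^sub>1 < 0\<close> everywhere or \<open>P\<^sub>1 = 0\<close> everywhere; in the latter case \<open>|u|\<^sup>2\<close> is a constant \<open>c\<close> with
  \<open>(1 - c)\<^sup>2 = 0\<close>, hence \<open>\<nabla>u = 0\<close>.

  As \<open>u\<close> is only \<open>C\<^sup>2\<close>, \<open>P\<^sub>a\<close> need not be twice differentiable. Its differential inequality holds
  in the viscosity sense, because replacing the partial derivatives of \<open>u\<close> in \<open>P\<^sub>a\<close> by difference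
  quotients gives \<open>C\<^sup>2\<close> functions to which the same computation applies.
\<close>

section \<open>Gradient and Laplacian at a point\<close>

text \<open>
  Only second derivatives along the coordinate lines through \<open>x\<close> are recorded: this is all that
  the second derivative test for the Laplacian needs.
\<close>

definition has_line_derivs ::
    "(real ^ 'n::finite \<Rightarrow> 'b::real_normed_vector) \<Rightarrow> real ^ 'n \<Rightarrow> real ^ 'n \<Rightarrow> 'b \<Rightarrow> 'b \<Rightarrow> bool" where
  "has_line_derivs f e x a b \<longleftrightarrow>
    (\<exists>g. (\<forall>\<^sub>F t in nhds 0. ((\<lambda>s. f (x + s *\<^sub>R e)) has_vector_derivative g t) (at t)) \<and>
         g 0 = a \<and> (g has_vector_derivative b) (at 0))"

definition has_grad_lap ::
    "(real ^ 'n::finite \<Rightarrow> 'b::real_normed_vector) \<Rightarrow> real ^ 'n \<Rightarrow> ('n \<Rightarrow> 'b) \<Rightarrow> 'b \<Rightarrow> bool" where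
  "has_grad_lap f x D L \<longleftrightarrow>
    (\<exists>b. (\<forall>i. has_line_derivs f (axis i 1) x (D i) (b i)) \<and> L = (\<Sum>i\<in>UNIV. b i))"

section \<open>Calculus of second derivatives along a line\<close>

lemma has_line_derivs_add:
  assumes "has_line_derivs f e x a b" "has_line_derivs g e x c d"
  shows "has_line_derivs (\<lambda>y. f y + g y) e x (a + c) (b + d)"
proof -
  obtain f' where f': "\<forall>\<^sub>F t in nhds 0. ((\<lambda>s. f (x + s *\<^sub>R e)) has_vector_derivative f' t) (at t)"
    "f' 0 = a" "(f' has_vector_derivative b) (at 0)"
    using assms(1) unfolding has_line_derivs_def by blast
  obtain g' where g': "\<forall>\<^sub>F t in nhds 0. ((\<lambda>s. g (x + s *\<^sub>R e)) has_vector_derivative g' t) (at t)"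
    "g' 0 = c" "(g' has_vector_derivative d) (at 0)"
    using assms(2) unfolding has_line_derivs_def by blast
  show ?thesis
    unfolding has_line_derivs_def
  proof (intro exI[of _ "\<lambda>t. f' t + g' t"] conjI)
    show "\<forall>\<^sub>F t in nhds 0. ((\<lambda>s. f (x + s *\<^sub>R e) + g (x + s *\<^sub>R e))
        has_vector_derivative f' t + g' t) (at t)"
      using f'(1) g'(1) by eventually_elim (rule has_vector_derivative_add)
    show "((\<lambda>t. f' t + g' t) has_vector_derivative b + d) (at 0)"
      by (rule has_vector_derivative_add[OF f'(3) g'(3)])
  qed (use f' g' in simp)
qed

lemma has_line_derivs_linear:
  assumes "bounded_linear T" "has_line_derivs f e x a b"
  shows "has_line_derivs (\<lambda>y. T (f y)) e x (T a) (T b)"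
proof -
  obtain f' where f': "\<forall>\<^sub>F t in nhds 0. ((\<lambda>s. f (x + s *\<^sub>R e)) has_vector_derivative f' t) (at t)"
    "f' 0 = a" "(f' has_vector_derivative b) (at 0)"
    using assms(2) unfolding has_line_derivs_def by blast
  show ?thesis
    unfolding has_line_derivs_def
  proof (intro exI[of _ "\<lambda>t. T (f' t)"] conjI)
    show "\<forall>\<^sub>F t in nhds 0. ((\<lambda>s. T (f (x + s *\<^sub>R e))) has_vector_derivative T (f' t)) (at t)"
      using f'(1) by eventually_elim (rule bounded_linear.has_vector_derivative[OF assms(1)])
    show "((\<lambda>t. T (f' t)) has_vector_derivative T b) (at 0)"
      by (rule bounded_linear.has_vector_derivative[OF assms(1) f'(3)])
  qed (use f' in simp)
qed

lemma has_line_derivs_inner: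
  fixes f g :: "real ^ 'n::finite \<Rightarrow> 'b::real_inner"
  assumes "has_line_derivs f e x a b" "has_line_derivs g e x c d"
  shows "has_line_derivs (\<lambda>y. f y \<bullet> g y) e x (f x \<bullet> c + a \<bullet> g x) (f x \<bullet> d + 2 * (a \<bullet> c) + b \<bullet> g x)"
proof -
  obtain f' where f': "\<forall>\<^sub>F t in nhds 0. ((\<lambda>s. f (x + s *\<^sub>R e)) has_vector_derivative f' t) (at t)"
    "f' 0 = a" "(f' has_vector_derivative b) (at 0)"
    using assms(1) unfolding has_line_derivs_def by blast
  obtain g' where g': "\<forall>\<^sub>F t in nhds 0. ((\<lambda>s. g (x + s *\<^sub>R e)) has_vector_derivative g' t) (at t)"
    "g' 0 = c" "(g' has_vector_derivative d) (at 0)"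
    using assms(2) unfolding has_line_derivs_def by blast
  have f0: "((\<lambda>s. f (x + s *\<^sub>R e)) has_vector_derivative a) (at 0)"
    using eventually_nhds_x_imp_x[OF f'(1)] f'(2) by simp
  have g0: "((\<lambda>s. g (x + s *\<^sub>R e)) has_vector_derivative c) (at 0)"
    using eventually_nhds_x_imp_x[OF g'(1)] g'(2) by simp
  note inner = bounded_bilinear.has_vector_derivative[OF bounded_bilinear_inner]
  show ?thesis
    unfolding has_line_derivs_def
  proof (intro exI[of _ "\<lambda>t. f (x + t *\<^sub>R e) \<bullet> g' t + f' t \<bullet> g (x + t *\<^sub>R e)"] conjI)
    show "\<forall>\<^sub>F t in nhds 0. ((\<lambda>s. f (x + s *\<^sub>R e) \<bullet> g (x + s *\<^sub>R e))
        has_vector_derivative f (x + t *\<^sub>R e) \<bullet> g' t + f' t \<bullet> g (x + t *\<^sub>R e)) (at t)"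
      using f'(1) g'(1) by eventually_elim (rule inner)
    have "((\<lambda>t. f (x + t *\<^sub>R e) \<bullet> g' t + f' t \<bullet> g (x + t *\<^sub>R e)) has_vector_derivative
        (f (x + 0 *\<^sub>R e) \<bullet> d + a \<bullet> g' 0) + (f' 0 \<bullet> c + b \<bullet> g (x + 0 *\<^sub>R e))) (at 0)"
      by (intro has_vector_derivative_add inner f0 g0 f'(3) g'(3))
    then show "((\<lambda>t. f (x + t *\<^sub>R e) \<bullet> g' t + f' t \<bullet> g (x + t *\<^sub>R e)) has_vector_derivative
        f x \<bullet> d + 2 * (a \<bullet> c) + b \<bullet> g x) (at 0)"
      by (simp add: f'(2) g'(2) algebra_simps)
  qed (use f' g' in simp)
qed

lemma has_line_derivs_chain:
  fixes f :: "real ^ 'n::finite \<Rightarrow> real"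
  assumes "has_line_derivs f e x a b"
    and h: "\<forall>\<^sub>F y in nhds (f x). (h has_real_derivative h' y) (at y)"
    and h': "(h' has_real_derivative c) (at (f x))"
  shows "has_line_derivs (\<lambda>y. h (f y)) e x (h' (f x) * a) (h' (f x) * b + c * a\<^sup>2)"
proof -
  obtain f' where f': "\<forall>\<^sub>F t in nhds 0. ((\<lambda>s. f (x + s *\<^sub>R e)) has_vector_derivative f' t) (at t)"
    "f' 0 = a" "(f' has_vector_derivative b) (at 0)"
    using assms(1) unfolding has_line_derivs_def by blast
  have f0: "((\<lambda>s. f (x + s *\<^sub>R e)) has_real_derivative a) (at 0)"
    using eventually_nhds_x_imp_x[OF f'(1)] f'(2)
    by (simp add: has_real_derivative_iff_has_vector_derivative)
  have "isCont (\<lambda>s. f (x + s *\<^sub>R e)) 0"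
    using f0 by (rule DERIV_isCont)
  then have "((\<lambda>s. f (x + s *\<^sub>R e)) \<longlongrightarrow> f x) (nhds 0)"
    using tendsto_at_iff_tendsto_nhds[of "\<lambda>s. f (x + s *\<^sub>R e)" 0] by (simp add: isCont_def)
  then have ev: "\<forall>\<^sub>F t in nhds 0. (h has_real_derivative h' (f (x + t *\<^sub>R e))) (at (f (x + t *\<^sub>R e)))"
    using h by (rule eventually_compose_filterlim[rotated])
  show ?thesis
    unfolding has_line_derivs_def has_real_derivative_iff_has_vector_derivative[symmetric]
  proof (intro exI[of _ "\<lambda>t. h' (f (x + t *\<^sub>R e)) * f' t"] conjI)
    show "\<forall>\<^sub>F t in nhds 0. ((\<lambda>s. h (f (x + s *\<^sub>R e)))
        has_real_derivative h' (f (x + t *\<^sub>R e)) * f' t) (at t)"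
      using f'(1) ev
      by eventually_elim
        (auto intro: DERIV_chain2 simp: has_real_derivative_iff_has_vector_derivative[symmetric])
    have 1: "((\<lambda>t. h' (f (x + t *\<^sub>R e))) has_real_derivative c * a) (at 0)"
      using h' by (intro DERIV_chain2[OF _ f0]) simp
    have 2: "(f' has_real_derivative b) (at 0)"
      using f'(3) by (simp add: has_real_derivative_iff_has_vector_derivative)
    show "((\<lambda>t. h' (f (x + t *\<^sub>R e)) * f' t) has_real_derivative
        h' (f x) * b + c * a\<^sup>2) (at 0)"
      using DERIV_mult[OF 1 2] f'(2) by (simp add: algebra_simps power2_eq_square)
  qed (use f' in simp)
qed

text \<open>Reversing the line changes the sign of the first derivative only; this is what keeps the
  Laplacian invariant under reflection.\<close>

lemma has_line_derivs_uminus: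
  assumes "has_line_derivs f (- e) x a b"
  shows "has_line_derivs f e x (- a) b"
proof -
  obtain f' where f': "\<forall>\<^sub>F t in nhds 0. ((\<lambda>s. f (x + s *\<^sub>R - e)) has_vector_derivative f' t) (at t)"
    "f' 0 = a" "(f' has_vector_derivative b) (at 0)"
    using assms unfolding has_line_derivs_def by blast
  have neg: "((\<lambda>s::real. - s) has_vector_derivative -1) (at t)" for t
    by (auto intro!: derivative_eq_intros)
  have "((\<lambda>s. - s) \<longlongrightarrow> (0::real)) (nhds 0)"
    using tendsto_minus[OF filterlim_ident[of "nhds (0::real)"]] by simp
  from eventually_compose_filterlim[OF f'(1) this]
  have ev: "\<forall>\<^sub>F t in nhds 0. ((\<lambda>s. f (x + s *\<^sub>R - e)) has_vector_derivative f' (- t)) (at (- t))" .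
  show ?thesis
    unfolding has_line_derivs_def
  proof (intro exI[of _ "\<lambda>t. - f' (- t)"] conjI)
    show "\<forall>\<^sub>F t in nhds 0. ((\<lambda>s. f (x + s *\<^sub>R e)) has_vector_derivative - f' (- t)) (at t)"
      using ev
    proof eventually_elim
      case (elim t)
      show ?case
        using vector_diff_chain_at[OF neg elim] by (simp add: o_def)
    qed
    have "((f' \<circ> (\<lambda>s. - s)) has_vector_derivative (-1) *\<^sub>R b) (at 0)"
      by (rule vector_diff_chain_at[OF neg]) (use f'(3) in simp)
    from has_vector_derivative_minus[OF this]
    show "((\<lambda>t. - f' (- t)) has_vector_derivative b) (at 0)"
      by (simp add: o_def)
  qed (use f' in simp)
qed

text \<open>The second derivative exists only at the point itself, so Taylor expansion is avoided:
  at a maximum \<open>a = 0\<close>, and \<open>b > 0\<close> would make \<open>f'\<close> positive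
  just to the right of 0, whence the mean value theorem gives a value above the maximum.\<close>

lemma has_line_derivs_max_nonpos:
  fixes f :: "real ^ 'n::finite \<Rightarrow> real"
  assumes "has_line_derivs f e x a b"
    and max: "\<forall>\<^sub>F t in nhds 0. f (x + t *\<^sub>R e) \<le> f x"
  shows "b \<le> 0"
proof (rule ccontr)
  assume "\<not> b \<le> 0"
  then have b: "b > 0" by simp
  obtain f' where f': "\<forall>\<^sub>F t in nhds 0. ((\<lambda>s. f (x + s *\<^sub>R e)) has_real_derivative f' t) (at t)"
    "f' 0 = a" "(f' has_real_derivative b) (at 0)"
    using assms(1) unfolding has_line_derivs_def has_real_derivative_iff_has_vector_derivative by blast
  obtain d1 where d1: "d1 > 0" "\<And>t. \<bar>t\<bar> < d1 \<Longrightarrow> f (x + t *\<^sub>R e) \<le> f x"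
    using max unfolding eventually_nhds_metric by (auto simp: dist_real_def)
  obtain d2 where d2: "d2 > 0"
    "\<And>t. \<bar>t\<bar> < d2 \<Longrightarrow> ((\<lambda>s. f (x + s *\<^sub>R e)) has_real_derivative f' t) (at t)"
    using f'(1) unfolding eventually_nhds_metric by (auto simp: dist_real_def)
  have "a = 0"
  proof (rule DERIV_local_max)
    show "((\<lambda>s. f (x + s *\<^sub>R e)) has_real_derivative a) (at 0)"
      using d2(2)[of 0] d2(1) f'(2) by simp
    show "\<forall>y. \<bar>0 - y\<bar> < d1 \<longrightarrow> f (x + y *\<^sub>R e) \<le> f (x + 0 *\<^sub>R e)"
      using d1(2) by auto
  qed (rule d1(1))
  from DERIV_pos_inc_right[OF f'(3) b] f'(2) this
  obtain d3 where d3: "d3 > 0" "\<And>h. h > 0 \<Longrightarrow> h < d3 \<Longrightarrow> 0 < f' h"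
    by auto
  define t where "t = min d1 (min d2 d3) / 2"
  have t: "0 < t" "t < d1" "t < d2" "t < d3"
    using d1(1) d2(1) d3(1) by (auto simp: t_def)
  obtain z where z: "0 < z" "z < t" "f (x + t *\<^sub>R e) - f (x + 0 *\<^sub>R e) = (t - 0) * f' z"
    using MVT2[of 0 t "\<lambda>s. f (x + s *\<^sub>R e)" f'] t d2(2) by force
  have "(t - 0) * f' z > 0"
    using z t d3(2)[of z] by simp
  then show False
    using z(3) d1(2)[of t] t by simp
qed

section \<open>Calculus of gradients and Laplacians\<close>

lemma has_grad_lap_add:
  assumes "has_grad_lap f x D L" "has_grad_lap g x E M"
  shows "has_grad_lap (\<lambda>y. f y + g y) x (\<lambda>i. D i + E i) (L + M)"
  using assms unfolding has_grad_lap_def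
  by (force intro: has_line_derivs_add simp: sum.distrib)

lemma has_grad_lap_linear:
  assumes "bounded_linear T" "has_grad_lap f x D L"
  shows "has_grad_lap (\<lambda>y. T (f y)) x (\<lambda>i. T (D i)) (T L)"
  using assms unfolding has_grad_lap_def
  using linear_sum[OF bounded_linear.linear[OF assms(1)]] has_line_derivs_linear[OF assms(1)]
  by metis

lemma has_grad_lap_cmult:
  fixes f :: "real ^ 'n::finite \<Rightarrow> real"
  assumes "has_grad_lap f x D L"
  shows "has_grad_lap (\<lambda>y. c * f y) x (\<lambda>i. c * D i) (c * L)"
  by (rule has_grad_lap_linear[OF bounded_linear_mult_right assms])

lemma has_grad_lap_diff:
  assumes "has_grad_lap f x D L" "has_grad_lap g x E M"
  shows "has_grad_lap (\<lambda>y. f y - g y) x (\<lambda>i. D i - E i) (L - M)"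
  using has_grad_lap_add[OF assms(1)
      has_grad_lap_linear[OF bounded_linear_minus[OF bounded_linear_ident] assms(2)]]
  by simp

lemma has_grad_lap_const: "has_grad_lap (\<lambda>y. c) x (\<lambda>i. 0) 0"
  unfolding has_grad_lap_def has_line_derivs_def by (auto intro!: exI[of _ "\<lambda>_. 0"])

lemma has_grad_lap_ident: "has_grad_lap (\<lambda>y. y) x (\<lambda>i. axis i 1) 0"
  unfolding has_grad_lap_def has_line_derivs_def
  by (rule exI[of _ "\<lambda>_. 0"])
    (auto intro!: exI[of _ "\<lambda>t. axis i 1" for i] always_eventually derivative_eq_intros)

lemma has_grad_lap_sum:
  assumes "\<And>k. k \<in> S \<Longrightarrow> has_grad_lap (f k) x (D k) (L k)"
  shows "has_grad_lap (\<lambda>y. \<Sum>k\<in>S. f k y) x (\<lambda>i. \<Sum>k\<in>S. D k i) (\<Sum>k\<in>S. L k)"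
  using assms
  by (induction S rule: infinite_finite_induct)
    (simp_all add: has_grad_lap_const has_grad_lap_add)

lemma has_grad_lap_inner:
  fixes f g :: "real ^ 'n::finite \<Rightarrow> 'b::real_inner"
  assumes "has_grad_lap f x D L" "has_grad_lap g x E M"
  shows "has_grad_lap (\<lambda>y. f y \<bullet> g y) x (\<lambda>i. f x \<bullet> E i + D i \<bullet> g x)
    (f x \<bullet> M + 2 * (\<Sum>i\<in>UNIV. D i \<bullet> E i) + L \<bullet> g x)"
proof -
  obtain b where b: "\<And>i. has_line_derivs f (axis i 1) x (D i) (b i)" "L = (\<Sum>i\<in>UNIV. b i)"
    using assms(1) unfolding has_grad_lap_def by blast
  obtain c where c: "\<And>i. has_line_derivs g (axis i 1) x (E i) (c i)" "M = (\<Sum>i\<in>UNIV. c i)"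
    using assms(2) unfolding has_grad_lap_def by blast
  show ?thesis
    unfolding has_grad_lap_def
    by (rule exI[of _ "\<lambda>i. f x \<bullet> c i + 2 * (D i \<bullet> E i) + b i \<bullet> g x"])
      (auto intro: has_line_derivs_inner b c
        simp: b(2) c(2) sum.distrib inner_sum_left inner_sum_right sum_distrib_left)
qed

lemma has_grad_lap_norm_sq:
  fixes f :: "real ^ 'n::finite \<Rightarrow> 'b::real_inner"
  assumes "has_grad_lap f x D L"
  shows "has_grad_lap (\<lambda>y. (norm (f y))\<^sup>2) x (\<lambda>i. 2 * (f x \<bullet> D i))
    (2 * (\<Sum>i\<in>UNIV. (norm (D i))\<^sup>2) + 2 * (f x \<bullet> L))"
  using has_grad_lap_inner[OF assms assms]
  by (simp add: power2_norm_eq_inner inner_commute algebra_simps)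

lemma has_grad_lap_chain:
  fixes f :: "real ^ 'n::finite \<Rightarrow> real"
  assumes "has_grad_lap f x D L"
    and "\<forall>\<^sub>F y in nhds (f x). (h has_real_derivative h' y) (at y)"
    and "(h' has_real_derivative c) (at (f x))"
  shows "has_grad_lap (\<lambda>y. h (f y)) x (\<lambda>i. h' (f x) * D i)
    (h' (f x) * L + c * (\<Sum>i\<in>UNIV. (D i)\<^sup>2))"
proof -
  obtain b where b: "\<And>i. has_line_derivs f (axis i 1) x (D i) (b i)" "L = (\<Sum>i\<in>UNIV. b i)"
    using assms(1) unfolding has_grad_lap_def by blast
  show ?thesis
    unfolding has_grad_lap_def
    by (rule exI[of _ "\<lambda>i. h' (f x) * b i + c * (D i)\<^sup>2"])
      (auto intro: has_line_derivs_chain b assms simp: b(2) sum.distrib sum_distrib_left)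
qed

lemma has_grad_lap_shift:
  assumes "has_grad_lap f (c + x) D L"
  shows "has_grad_lap (\<lambda>y. f (c + y)) x D L"
  using assms unfolding has_grad_lap_def has_line_derivs_def by (simp add: add.assoc)

lemma has_grad_lap_reflect:
  fixes f :: "real ^ 'n::finite \<Rightarrow> 'b::real_normed_vector" and i :: 'n
  defines "R \<equiv> \<lambda>y::real ^ 'n. y - (2 * y $ i) *\<^sub>R axis i 1"
  assumes "has_grad_lap f (R x) D L"
  shows "has_grad_lap (\<lambda>y. f (R y)) x (D(i := - D i)) L"
proof -
  obtain b where b: "\<And>k. has_line_derivs f (axis k 1) (R x) (D k) (b k)" "L = (\<Sum>i\<in>UNIV. b i)"
    using assms(2) unfolding has_grad_lap_def by blast
  have same: "R (x + t *\<^sub>R axis k 1) = R x + t *\<^sub>R axis k 1" if "k \<noteq> i" for t k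
    using that by (simp add: R_def axis_def)
  have flip: "R (x + t *\<^sub>R axis i 1) = R x + t *\<^sub>R - axis i 1" for t
    by (simp add: R_def axis_def algebra_simps vec_eq_iff)
  have "has_line_derivs (\<lambda>y. f (R y)) (axis k 1) x ((D(i := - D i)) k) (b k)" for k
  proof (cases "k = i")
    case True
    have "has_line_derivs f (- axis i 1) (R x) (- D i) (b i)"
      by (rule has_line_derivs_uminus) (use b in simp)
    then show ?thesis
      using True unfolding has_line_derivs_def by (simp only: flip fun_upd_same)
  next
    case False
    then show ?thesis
      using b(1)[of k] unfolding has_line_derivs_def same[OF False] by simp
  qed
  with b(2) show ?thesis
    unfolding has_grad_lap_def by blast
qed

text \<open>Short coordinate segments through an interior point stay in \<open>K\<close>, so the
  one-dimensional test applies to every summand of \<open>L\<close>. The comparison arguments apply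
  this to the difference of a function and a barrier.\<close>

lemma has_grad_lap_max_nonpos:
  fixes f :: "real ^ 'n::finite \<Rightarrow> real"
  assumes "has_grad_lap f x D L" and "x \<in> interior K" and "\<And>y. y \<in> K \<Longrightarrow> f y \<le> f x"
  shows "L \<le> 0"
proof -
  obtain b where b: "\<And>i. has_line_derivs f (axis i 1) x (D i) (b i)" "L = (\<Sum>i\<in>UNIV. b i)"
    using assms(1) unfolding has_grad_lap_def by blast
  have "b i \<le> 0" for i
  proof (rule has_line_derivs_max_nonpos[OF b(1)])
    have "((\<lambda>t. x + t *\<^sub>R axis i 1) \<longlongrightarrow> x + 0 *\<^sub>R axis i 1) (nhds 0)"
      by (intro tendsto_intros filterlim_ident)
    then have "\<forall>\<^sub>F t in nhds 0. x + t *\<^sub>R axis i 1 \<in> interior K"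
      by (rule topological_tendstoD) (use assms(2) in auto)
    then show "\<forall>\<^sub>F t in nhds 0. f (x + t *\<^sub>R axis i 1) \<le> f x"
      by eventually_elim (use interior_subset assms(3) in blast)
  qed
  then show ?thesis
    unfolding b(2) by (intro sum_nonpos) auto
qed

section \<open>Tools for comparison on balls\<close>

lemma has_grad_lap_dist_sq:
  fixes x z :: "real ^ 'n::finite"
  shows "has_grad_lap (\<lambda>y. (norm (y - z))\<^sup>2) x (\<lambda>i. 2 * (x - z) $ i) (2 * real CARD('n))"
  using has_grad_lap_norm_sq[OF has_grad_lap_diff[OF has_grad_lap_ident has_grad_lap_const], of z x]
  by (simp add: inner_axis)

lemma sum_component_sq: "(\<Sum>i\<in>UNIV. (x $ i)\<^sup>2) = (norm (x :: real ^ 'n::finite))\<^sup>2"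
  by (simp only: power2_norm_eq_inner inner_vec_def inner_real_def) (simp only: power2_eq_square)

lemma sum_double_component_sq:
  "(\<Sum>i\<in>UNIV. (2 * x $ i)\<^sup>2) = 4 * (norm (x :: real ^ 'n::finite))\<^sup>2"
  by (simp add: sum_component_sq[symmetric] power_mult_distrib sum_distrib_left)

lemma compact_interior_max:
  fixes f :: "real ^ 'n::finite \<Rightarrow> real"
  assumes "compact K" "z \<in> K" "continuous_on K f"
    and "\<And>x. x \<in> K - interior K \<Longrightarrow> f x < f z"
  obtains x where "x \<in> interior K" "\<And>y. y \<in> K \<Longrightarrow> f y \<le> f x"
proof -
  obtain x where x: "x \<in> K" "\<And>y. y \<in> K \<Longrightarrow> f y \<le> f x"
    using continuous_attains_sup[OF assms(1) _ assms(3)] assms(2) by blast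
  then have "x \<in> interior K"
    using assms(2,4) by force
  with x(2) that show ?thesis by blast
qed

lemma norm_frontier_cball:
  fixes x z :: "real ^ 'n::finite"
  assumes "x \<in> cball z r - interior (cball z r)"
  shows "norm (x - z) = r"
  using assms by (auto simp: dist_norm norm_minus_commute)

text \<open>Supplies both derivatives of the barrier profile \<open>A * S / (S - y)\<^sup>2\<close>,
  with \<open>k = 1\<close> and then \<open>k = 2\<close>.\<close>

lemma DERIV_const_divide_power:
  fixes c S y :: real
  assumes "y \<noteq> S"
  shows "((\<lambda>y. c / (S - y) ^ Suc k) has_real_derivative real (Suc k) * c / (S - y) ^ Suc (Suc k)) (at y)"
proof -
  have "((\<lambda>s. c / s ^ Suc k) has_real_derivative - (real (Suc k) * c) / s ^ Suc (Suc k)) (at s)"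
    if "s \<noteq> 0" for s
    using DERIV_quotient[OF DERIV_const DERIV_pow[of "Suc k"], of s c] that
    by (simp add: power2_eq_square divide_simps)
  from DERIV_chain2[where f = "\<lambda>s. c / s ^ Suc k" and g = "\<lambda>y. S - y" and x = y and s = UNIV,
      OF this[of "S - y"], of "-1"] assms
  have "((\<lambda>y. S - y) has_real_derivative - 1) (at y) \<Longrightarrow> ?thesis" by simp
  moreover have "((\<lambda>y. S - y) has_real_derivative - 1) (at y)"
    by (auto intro!: derivative_eq_intros)
  ultimately show ?thesis by blast
qed

section \<open>A priori bounds\<close>

text \<open>The quadratic growth of the Laplacian allows comparison with a barrier that is infinite
  on a sphere, so no growth condition on \<open>f\<close> at infinity enters. Where
  \<open>f - \<phi>\<close> is maximal,
  \<open>F x \<le> 2 * (\<phi> x)\<^sup>2 < 2 * (f x)\<^sup>2\<close>, against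
  \<open>ineq\<close>.\<close>

lemma keller_osserman_nonpos:
  fixes f :: "real ^ 'n::finite \<Rightarrow> real"
  assumes cont: "continuous_on UNIV f"
    and jet: "\<And>x. has_grad_lap f x (D x) (F x)"
    and ineq: "\<And>x. f x > 0 \<Longrightarrow> 2 * (f x)\<^sup>2 \<le> F x"
  shows "f z \<le> 0"
proof (rule ccontr)
  assume "\<not> f z \<le> 0"
  then have fz: "f z > 0" by simp
  define n where "n = real CARD('n)"
  define A where "A = 2 * (n + 6)"
  \<comment> \<open>This radius gives the barrier the value \<open>A / S = f z / 2\<close> at the
    centre, so \<open>f - \<phi>\<close> is positive there.\<close>
  define S where "S = 2 * A / f z"
  have n: "n > 0" by (simp add: n_def)
  have A: "A > 0" using n by (simp add: A_def)
  have S: "S > 0" using fz A by (simp add: S_def)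
  have "\<exists>x\<in>cball z (sqrt S). \<forall>y\<in>cball z (sqrt S). f y \<le> f x"
    using S by (intro continuous_attains_sup continuous_on_subset[OF cont]) auto
  then obtain M0 where M0: "\<And>y. y \<in> cball z (sqrt S) \<Longrightarrow> f y \<le> M0"
    by blast
  define M where "M = max 1 M0"
  \<comment> \<open>The bound \<open>S / 2\<close> keeps the smaller radius positive; the other two
    give \<open>\<tau>\<^sup>2 \<le> \<tau> \<le> A * S / M\<close>, so that the barrier is at least
    \<open>M\<close> where \<open>S - y = \<tau>\<close>.\<close>
  define \<tau> where "\<tau> = min (S / 2) (min 1 (A * S / M))"
  have M: "M > 0" by (simp add: M_def)
  have \<tau>: "\<tau> > 0" "\<tau> \<le> S / 2" "\<tau> \<le> 1" "\<tau> \<le> A * S / M"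
    using divide_pos_pos[OF mult_pos_pos[OF A S] M] S unfolding \<tau>_def by linarith+
  have "\<tau>\<^sup>2 \<le> \<tau>"
    using \<tau> by (simp add: power2_eq_square mult_left_le)
  then have "M * \<tau>\<^sup>2 \<le> A * S"
    using \<tau>(4) M by (smt (verit) mult.commute mult_left_mono pos_le_divide_eq)
  then have barrier: "M \<le> A * S / \<tau>\<^sup>2"
    using \<tau>(1) by (simp add: pos_le_divide_eq)
  \<comment> \<open>The barrier blows up on the sphere of radius \<open>sqrt S\<close>; by the choice of \<open>A\<close> it satisfies
    \<open>\<Delta>\<phi> \<le> 2 \<phi>\<^sup>2\<close>, and on the slightly smaller sphere bounding \<open>K\<close> it exceeds \<open>f\<close>.\<close>
  define K where "K = cball z (sqrt (S - \<tau>))"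
  define h where "h = (\<lambda>y. A * S / (S - y)\<^sup>2)"
  define \<phi> where "\<phi> = (\<lambda>x. h ((norm (x - z))\<^sup>2))"
  have K: "(norm (x - z))\<^sup>2 \<le> S - \<tau>" if "x \<in> K" for x
  proof -
    have "norm (x - z) \<le> sqrt (S - \<tau>)"
      using that by (simp add: K_def dist_norm norm_minus_commute)
    then have "(norm (x - z))\<^sup>2 \<le> (sqrt (S - \<tau>))\<^sup>2"
      by (intro power_mono) auto
    then show ?thesis using \<tau> by simp
  qed
  have contK: "continuous_on K (\<lambda>x. f x - \<phi> x)"
    unfolding \<phi>_def h_def
    by (intro continuous_intros continuous_on_subset[OF cont]) (use K \<tau> in force)+
  have \<phi>z: "\<phi> z = f z / 2"
    using S fz A by (simp add: \<phi>_def h_def power2_eq_square) (simp add: S_def field_simps)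
  have "f x - \<phi> x < f z - \<phi> z" if x: "x \<in> K - interior K" for x
  proof -
    have "norm (x - z) = sqrt (S - \<tau>)"
      using norm_frontier_cball x unfolding K_def by blast
    then have "\<phi> x = A * S / \<tau>\<^sup>2"
      using \<tau> by (simp add: \<phi>_def h_def)
    moreover have "f x \<le> M"
    proof -
      have "K \<subseteq> cball z (sqrt S)"
        unfolding K_def using \<tau> by (intro subset_cball) simp
      then show ?thesis using x M0 by (force simp: M_def)
    qed
    ultimately show ?thesis
      using barrier \<phi>z fz by simp
  qed
  note bd = this
  have "compact K" and zK: "z \<in> K"
    using \<tau> by (simp_all add: K_def)
  then obtain x where x: "x \<in> interior K" "\<And>y. y \<in> K \<Longrightarrow> f y - \<phi> y \<le> f x - \<phi> x"
    using compact_interior_max[OF _ _ contK bd] by blast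
  define q where "q = (norm (x - z))\<^sup>2"
  define s where "s = S - q"
  have q: "0 \<le> q" "q \<le> S - \<tau>"
    using K[of x] x(1) interior_subset by (auto simp: q_def)
  have s: "0 < s" "s \<le> S"
    using q \<tau> by (auto simp: s_def)
  have ev: "\<forall>\<^sub>F y in nhds q. y < S"
    using q(2) \<tau>(1) by (intro order_tendstoD(2)[OF filterlim_ident]) auto
  have "has_grad_lap \<phi> x (\<lambda>i. 2 * A * S / (S - q) ^ 3 * (2 * (x - z) $ i))
    (2 * A * S / (S - q) ^ 3 * (2 * real CARD('n))
      + 6 * A * S / (S - q) ^ 4 * (\<Sum>i\<in>UNIV. (2 * (x - z) $ i)\<^sup>2))"
    unfolding \<phi>_def q_def
  proof (rule has_grad_lap_chain[OF has_grad_lap_dist_sq, where h' = "\<lambda>y. 2 * A * S / (S - y) ^ 3"])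
    show "\<forall>\<^sub>F y in nhds ((norm (x - z))\<^sup>2).
        (h has_real_derivative 2 * A * S / (S - y) ^ 3) (at y)"
      using ev unfolding q_def[symmetric]
    proof eventually_elim
      case (elim y)
      then show ?case
        using DERIV_const_divide_power[of y S "A * S" 1]
        by (simp add: h_def numeral_2_eq_2 numeral_3_eq_3 mult.assoc)
    qed
    show "((\<lambda>y. 2 * A * S / (S - y) ^ 3) has_real_derivative
        6 * A * S / (S - (norm (x - z))\<^sup>2) ^ 4) (at ((norm (x - z))\<^sup>2))"
      using s(1) DERIV_const_divide_power[of q S "2 * A * S" 2]
      unfolding q_def[symmetric] s_def by (simp add: eval_nat_numeral mult.assoc)
  qed
  moreover have "(\<Sum>i\<in>UNIV. (2 * (x - z) $ i)\<^sup>2) = 4 * q"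
    unfolding q_def by (rule sum_double_component_sq)
  ultimately have "has_grad_lap \<phi> x (\<lambda>i. 2 * A * S / s ^ 3 * (2 * (x - z) $ i))
    (2 * A * S / s ^ 3 * (2 * n) + 6 * A * S / s ^ 4 * (4 * q))"
    by (simp add: s_def n_def)
  from has_grad_lap_diff[OF jet this]
  have "F x - (2 * A * S / s ^ 3 * (2 * n) + 6 * A * S / s ^ 4 * (4 * q)) \<le> 0"
    by (rule has_grad_lap_max_nonpos[OF _ x(1)]) (use x(2) in auto)
  also have "2 * A * S / s ^ 3 * (2 * n) + 6 * A * S / s ^ 4 * (4 * q)
      = 4 * A * S / s ^ 4 * (n * s + 6 * q)"
    using s(1) by (simp add: field_simps power3_eq_cube power4_eq_xxxx)
  finally have "F x \<le> 4 * A * S / s ^ 4 * (n * s + 6 * q)" by simp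
  \<comment> \<open>Both \<open>s\<close> and \<open>q\<close> are at most \<open>S\<close>. Since
    \<open>A = 2 * (n + 6)\<close>, the resulting bound is exactly twice the square of the
    barrier.\<close>
  also have "\<dots> \<le> 4 * A * S / s ^ 4 * ((n + 6) * S)"
  proof (rule mult_left_mono)
    have "n * s \<le> n * S" using s n by (intro mult_left_mono) auto
    then show "n * s + 6 * q \<le> (n + 6) * S"
      using q \<tau>(1) by (simp add: algebra_simps)
  qed (use A S s in auto)
  also have "\<dots> = 2 * (A * S / s\<^sup>2)\<^sup>2"
    by (simp add: A_def power_divide power_mult_distrib power2_eq_square power4_eq_xxxx algebra_simps)
  also have "A * S / s\<^sup>2 = \<phi> x"
    by (simp add: \<phi>_def h_def s_def q_def)
  finally have Fle: "F x \<le> 2 * (\<phi> x)\<^sup>2" .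
  have "\<phi> x < f x"
    using x(2)[OF zK] \<phi>z fz by simp
  moreover have "\<phi> x > 0"
    using s(1) A S by (simp add: \<phi>_def h_def q_def[symmetric] s_def[symmetric])
  ultimately have "(\<phi> x)\<^sup>2 < (f x)\<^sup>2"
    by (intro power_strict_mono) auto
  with Fle ineq[of x] \<open>\<phi> x < f x\<close> \<open>\<phi> x > 0\<close> show False by simp
qed

text \<open>
  Brandt's comparison argument: the odd part of \<open>f\<close> under the reflection in the hyperplane
  through \<open>x0\<close> orthogonal to \<open>axis i 1\<close> vanishes on that hyperplane and has a bounded Laplacian.
\<close>

lemma gradient_bound_aux:
  fixes f :: "real ^ 'n::finite \<Rightarrow> real"
  assumes cont: "continuous_on UNIV f"
    and jet: "\<And>x. has_grad_lap f x (D x) (F x)"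
    and f: "\<And>x. \<bar>f x\<bar> \<le> 1" and F: "\<And>x. \<bar>F x\<bar> \<le> 1"
    and t: "0 < t" "t < 1"
  shows "f (x0 + t *\<^sub>R axis i 1) - f (x0 - t *\<^sub>R axis i 1) \<le> 4 * t"
proof -
  define n where "n = real CARD('n)"
  \<comment> \<open>With this value the Laplacian of \<open>\<psi>\<close> is
    \<open>- 4 + 2 * n * \<delta> = - 3\<close>, strictly below that of \<open>\<phi>\<close>, which
    is at least \<open>- 2\<close> because \<open>\<bar>F\<bar> \<le> 1\<close>.\<close>
  define \<delta> where "\<delta> = 1 / (2 * n)"
  have n: "n \<ge> 1" by (simp add: n_def)
  have \<delta>: "\<delta> > 0" "\<delta> \<le> 1" "2 * n * \<delta> = 1" using n by (auto simp: \<delta>_def)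
  define R where "R = (\<lambda>y::real ^ 'n. y - (2 * y $ i) *\<^sub>R axis i 1)"
  define \<phi> where "\<phi> = (\<lambda>y. f (x0 + y) - f (x0 + R y))"
  \<comment> \<open>This barrier dominates \<open>\<phi>\<close> on each part of the frontier of
    \<open>K\<close>: on the face \<open>y $ i = 0\<close>, where \<open>\<phi>\<close> vanishes, it
    is nonnegative; on the face \<open>y $ i = 1\<close> the first two terms give 2; on the sphere
    of radius \<open>sqrt (4 * n)\<close> the last term equals 2. Always
    \<open>\<phi> \<le> 2\<close>.\<close>
  define \<psi> where "\<psi> = (\<lambda>y::real ^ 'n. 4 * y $ i - 2 * (norm (y $ i))\<^sup>2 + \<delta> * (norm (y - 0))\<^sup>2)"
  define K where "K = {y::real ^ 'n. 0 \<le> y $ i \<and> y $ i \<le> 1} \<inter> cball 0 (sqrt (4 * n))"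
  have \<phi>2: "\<phi> y \<le> 2" for y
    using f[of "x0 + y"] f[of "x0 + R y"] by (simp add: \<phi>_def)
  have \<psi>jet: "\<exists>E. has_grad_lap \<psi> y E (- 3)" for y
  proof -
    have c: "has_grad_lap (\<lambda>y. y $ i) y (\<lambda>k. axis k 1 $ i) (0::real)"
      using has_grad_lap_linear[OF bounded_linear_vec_nth has_grad_lap_ident] by simp
    have "has_grad_lap \<psi> y
      (\<lambda>k. 4 * axis k 1 $ i - 2 * (2 * (y $ i \<bullet> axis k 1 $ i)) + \<delta> * (2 * (y - 0) $ k))
      (4 * 0 - 2 * (2 * (\<Sum>k\<in>UNIV. (norm (axis k 1 $ i :: real))\<^sup>2) + 2 * (y $ i \<bullet> 0))
        + \<delta> * (2 * real CARD('n)))"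
      unfolding \<psi>_def
      by (intro has_grad_lap_add has_grad_lap_diff has_grad_lap_cmult has_grad_lap_norm_sq
        has_grad_lap_dist_sq c)
    moreover have "(\<Sum>k\<in>UNIV. (norm (axis k 1 $ i :: real))\<^sup>2) = 1"
    proof -
      have "(\<Sum>k\<in>UNIV. (norm (axis k 1 $ i :: real))\<^sup>2) = (\<Sum>k\<in>UNIV. if k = i then 1 else 0)"
        by (intro sum.cong) (auto simp: axis_def)
      then show ?thesis by simp
    qed
    ultimately show ?thesis
      using \<delta>(3) by (auto simp: n_def algebra_simps)
  qed
  have \<phi>jet: "\<exists>E. has_grad_lap \<phi> y E (F (x0 + y) - F (x0 + R y))" for y
    unfolding \<phi>_def R_def
    by (intro exI, rule has_grad_lap_diff[OF has_grad_lap_shift[OF jet]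
      has_grad_lap_reflect[where f = "\<lambda>y. f (x0 + y)", OF has_grad_lap_shift[OF jet]]])
  have Kc: "compact K"
    unfolding K_def Collect_conj_eq
    by (intro closed_Int_compact closed_Int closed_halfspace_component_le_cart
      closed_halfspace_component_ge_cart compact_cball)
  have Kint: "{y. 0 < y $ i \<and> y $ i < 1} \<inter> ball 0 (sqrt (4 * n)) \<subseteq> interior K"
  proof (rule interior_maximal)
    show "open ({y::real ^ 'n. 0 < y $ i \<and> y $ i < 1} \<inter> ball 0 (sqrt (4 * n)))"
      unfolding Collect_conj_eq
      by (intro open_Int open_halfspace_component_lt_cart open_halfspace_component_gt_cart open_Collect_less continuous_intros open_ball)
  qed (auto simp: K_def)
  have \<phi>c: "continuous_on K (\<lambda>y. \<phi> y - \<psi> y)"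
    unfolding \<phi>_def \<psi>_def R_def
    by (intro continuous_intros continuous_on_compose2[OF cont]) auto
  have bd: "\<phi> y - \<psi> y \<le> 0" if y: "y \<in> K - interior K" for y
  proof -
    have yi: "0 \<le> y $ i" "y $ i \<le> 1" using y by (auto simp: K_def)
    have "0 \<le> y $ i * (2 - y $ i)" using yi by simp
    then have lb: "\<delta> * (norm y)\<^sup>2 \<le> \<psi> y"
      by (simp add: \<psi>_def power2_eq_square algebra_simps)
    consider "y $ i = 0" | "y $ i = 1" | "norm y = sqrt (4 * n)"
      using y Kint by (force simp: K_def)
    then show ?thesis
    proof cases
      case 1
      then have "\<phi> y = 0" by (simp add: \<phi>_def R_def)
      moreover have "0 \<le> \<delta> * (norm y)\<^sup>2" using \<delta> by simp
      ultimately show ?thesis using lb by linarith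
    next
      case 2
      then have "2 \<le> \<psi> y" using \<delta> by (simp add: \<psi>_def)
      then show ?thesis using \<phi>2[of y] by linarith
    next
      case 3
      then have "\<delta> * (norm y)\<^sup>2 = 2" using n by (simp add: \<delta>_def)
      then show ?thesis using lb \<phi>2[of y] by linarith
    qed
  qed
  have le: "\<phi> z \<le> \<psi> z" if z: "z \<in> K" for z
  proof (rule ccontr)
    assume "\<not> \<phi> z \<le> \<psi> z"
    with bd have "\<phi> x - \<psi> x < \<phi> z - \<psi> z" if "x \<in> K - interior K" for x
      using that by force
    then obtain x where x: "x \<in> interior K" "\<And>y. y \<in> K \<Longrightarrow> \<phi> y - \<psi> y \<le> \<phi> x - \<psi> x"
      using compact_interior_max[OF Kc z \<phi>c] by blast
    obtain E1 E2 where "has_grad_lap \<phi> x E1 (F (x0 + x) - F (x0 + R x))" "has_grad_lap \<psi> x E2 (- 3)"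
      using \<phi>jet \<psi>jet by blast
    from has_grad_lap_diff[OF this]
    have "F (x0 + x) - F (x0 + R x) - (- 3) \<le> 0"
      by (rule has_grad_lap_max_nonpos[OF _ x(1)]) (use x(2) in auto)
    then show False
      using F[of "x0 + x"] F[of "x0 + R x"] by (simp add: abs_le_iff)
  qed
  define z where "z = t *\<^sub>R axis i (1::real)"
  have zi: "z $ i = t" by (simp add: z_def)
  have nz: "norm z = t" using t by (simp add: z_def norm_axis_1)
  have "1 \<le> sqrt (4 * n)" using n by simp
  then have "z \<in> K" using t zi nz unfolding K_def by (simp del: real_sqrt_ge_1_iff real_sqrt_mult)
  from le[OF this] have "\<phi> z \<le> 4 * t - 2 * t\<^sup>2 + \<delta> * t\<^sup>2"
    using nz zi by (simp add: \<psi>_def)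
  \<comment> \<open>Since \<open>\<delta> \<le> 1\<close>, the term \<open>- 2 * t\<^sup>2\<close>
    absorbs \<open>\<delta> * t\<^sup>2\<close>.\<close>
  also have "\<dots> \<le> 4 * t"
    using mult_right_mono[OF \<delta>(2), of "t\<^sup>2"] zero_le_power2[of t] by linarith
  also have "R z = - z"
    using scaleR_2[of z] by (simp add: R_def zi) (simp add: z_def)
  then have "\<phi> z = f (x0 + t *\<^sub>R axis i 1) - f (x0 - t *\<^sub>R axis i 1)"
    by (simp add: \<phi>_def z_def)
  finally show ?thesis .
qed

text \<open>The symmetric difference quotient tends to twice the partial derivative, and the
  reflection estimate bounds it by 4.\<close>

lemma gradient_bound_le:
  fixes f :: "real ^ 'n::finite \<Rightarrow> real"
  assumes cont: "continuous_on UNIV f"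
    and jet: "\<And>x. has_grad_lap f x (D x) (F x)"
    and f: "\<And>x. \<bar>f x\<bar> \<le> 1" and F: "\<And>x. \<bar>F x\<bar> \<le> 1"
  shows "D x i \<le> 2"
proof -
  have "((\<lambda>s. f (x + s *\<^sub>R axis i 1)) has_real_derivative D x i) (at 0)"
    using jet[of x] eventually_nhds_x_imp_x
    unfolding has_grad_lap_def has_line_derivs_def has_real_derivative_iff_has_vector_derivative
    by metis
  note d = this
  have "((\<lambda>s. f (x + (- s) *\<^sub>R axis i 1)) has_real_derivative D x i * (- 1)) (at 0)"
    by (rule DERIV_chain2[where f = "\<lambda>s. f (x + s *\<^sub>R axis i 1)"])
      (use d in \<open>auto intro!: derivative_eq_intros\<close>)
  from DERIV_diff[OF d this]
  have "((\<lambda>s. f (x + s *\<^sub>R axis i 1) - f (x + (- s) *\<^sub>R axis i 1)) has_real_derivative 2 * D x i) (at 0)"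
    by simp
  then have lim: "((\<lambda>s. (f (x + s *\<^sub>R axis i 1) - f (x - s *\<^sub>R axis i 1)) / s) \<longlongrightarrow> 2 * D x i) (at_right 0)"
    unfolding DERIV_def by (simp add: filterlim_at_split)
  have "2 * D x i \<le> 4"
  proof (rule tendsto_upperbound[OF lim])
    have "\<forall>\<^sub>F s::real in at_right 0. 0 < s \<and> s < 1"
      by (rule eventually_at_rightI[of 0 1]) auto
    then show "\<forall>\<^sub>F s in at_right 0. (f (x + s *\<^sub>R axis i 1) - f (x - s *\<^sub>R axis i 1)) / s \<le> 4"
    proof eventually_elim
      case (elim s)
      then show ?case
        using gradient_bound_aux[OF cont jet f F, of s x i] by (simp add: pos_divide_le_eq)
    qed
  qed simp
  then show ?thesis by simp
qed

lemma gradient_bound: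
  fixes f :: "real ^ 'n::finite \<Rightarrow> real"
  assumes cont: "continuous_on UNIV f"
    and jet: "\<And>x. has_grad_lap f x (D x) (F x)"
    and f: "\<And>x. \<bar>f x\<bar> \<le> 1" and F: "\<And>x. \<bar>F x\<bar> \<le> 1"
  shows "\<bar>D x i\<bar> \<le> 2"
proof -
  have "D x i \<le> 2"
    by (rule gradient_bound_le[OF assms])
  moreover have "- D x i \<le> 2"
  proof (rule gradient_bound_le[where D = "\<lambda>x i. - D x i" and f = "\<lambda>x. - f x" and F = "\<lambda>x. - F x"])
    show "has_grad_lap (\<lambda>x. - f x) y (\<lambda>i. - D y i) (- F y)" for y
      using has_grad_lap_cmult[OF jet[of y], of "-1"] by simp
  qed (use f F cont in \<open>auto intro: continuous_intros\<close>)
  ultimately show ?thesis by (simp add: abs_le_iff)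
qed

section \<open>Viscosity subsolutions\<close>

text \<open>
  \<open>visc_sub P G\<close> encodes \<open>\<Delta>P \<ge> G\<close> in the viscosity sense: if \<open>P - \<psi>\<close> is smaller on the frontier of
  \<open>K\<close> than at some point of \<open>K\<close>, it is touched from above at an interior point where \<open>G \<le> \<Delta>\<psi>\<close>.
\<close>

definition visc_sub :: "(real ^ 'n::finite \<Rightarrow> real) \<Rightarrow> (real ^ 'n \<Rightarrow> real) \<Rightarrow> bool" where
  "visc_sub P G \<longleftrightarrow> (\<forall>K \<psi> E H z. compact K \<and> z \<in> K \<and> continuous_on UNIV \<psi> \<and> continuous_on UNIV H \<and>
      (\<forall>x. has_grad_lap \<psi> x (E x) (H x)) \<and> (\<forall>x \<in> K - interior K. P x - \<psi> x < P z - \<psi> z) \<longrightarrow>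
      (\<exists>x \<in> interior K. P z - \<psi> z \<le> P x - \<psi> x \<and> G x \<le> H x))"

lemma visc_subD:
  assumes "visc_sub P G" "compact K" "z \<in> K" "continuous_on UNIV \<psi>" "continuous_on UNIV H"
    and "\<And>x. has_grad_lap \<psi> x (E x) (H x)"
    and "\<And>x. x \<in> K - interior K \<Longrightarrow> P x - \<psi> x < P z - \<psi> z"
  obtains x where "x \<in> interior K" "P z - \<psi> z \<le> P x - \<psi> x" "G x \<le> H x"
  using assms(1)[unfolded visc_sub_def, rule_format, of K z \<psi> H E] assms(2-) by blast

text \<open>Stability of viscosity subsolutions under approximation. Convergence along
  \<open>h \<longlonglongrightarrow> 0\<close> and \<open>X \<longlonglongrightarrow> x\<close>
  together is what lets maximum points of \<open>Q h - \<psi>\<close> over \<open>K\<close> pass to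
  a cluster point, with their inequalities.\<close>

lemma visc_sub_limit:
  fixes Q :: "real \<Rightarrow> real ^ 'n::finite \<Rightarrow> real"
  assumes cont: "\<And>h. h > 0 \<Longrightarrow> continuous_on UNIV (Q h)"
    and jet: "\<And>h x. h > 0 \<Longrightarrow> \<exists>E. \<exists>L \<ge> G' h x. has_grad_lap (Q h) x E L"
    and limP: "\<And>h X x. (\<And>j. h j > 0) \<Longrightarrow> h \<longlonglongrightarrow> 0 \<Longrightarrow> X \<longlonglongrightarrow> x \<Longrightarrow>
      (\<lambda>j::nat. Q (h j) (X j)) \<longlonglongrightarrow> P x"
    and limG: "\<And>h X x. (\<And>j. h j > 0) \<Longrightarrow> h \<longlonglongrightarrow> 0 \<Longrightarrow> X \<longlonglongrightarrow> x \<Longrightarrow>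
      (\<lambda>j::nat. G' (h j) (X j)) \<longlonglongrightarrow> G x"
  shows "visc_sub P G"
  unfolding visc_sub_def
proof (intro allI impI, elim conjE)
  fix K \<psi> E H and z :: "real ^ 'n"
  assume K: "compact K" "z \<in> K" and \<psi>: "continuous_on UNIV \<psi>" and H: "continuous_on UNIV H"
    and \<psi>jet: "\<forall>x. has_grad_lap \<psi> x (E x) (H x)"
    and bd: "\<forall>x \<in> K - interior K. P x - \<psi> x < P z - \<psi> z"
  define h where "h = (\<lambda>j. inverse (real (Suc j)))"
  have h: "h j > 0" for j by (simp add: h_def)
  have h0: "h \<longlonglongrightarrow> 0" unfolding h_def by (rule LIMSEQ_inverse_real_of_nat)
  have "\<exists>x\<in>K. \<forall>y\<in>K. Q (h j) y - \<psi> y \<le> Q (h j) x - \<psi> x" for j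
    by (rule continuous_attains_sup)
      (use K in \<open>auto intro!: continuous_on_diff continuous_on_subset[OF cont[OF h]] continuous_on_subset[OF \<psi>]\<close>)
  then obtain X where X: "\<And>j. X j \<in> K" "\<And>j y. y \<in> K \<Longrightarrow> Q (h j) y - \<psi> y \<le> Q (h j) (X j) - \<psi> (X j)"
    by metis
  obtain x r where x: "x \<in> K" "strict_mono r" "(X \<circ> r) \<longlonglongrightarrow> x"
    using K(1) X(1) unfolding compact_def by metis
  have hr: "h (r j) > 0" for j by (rule h)
  have hr0: "(\<lambda>j. h (r j)) \<longlonglongrightarrow> 0"
    using LIMSEQ_subseq_LIMSEQ[OF h0 x(2)] by (simp add: o_def)
  have Xr: "(\<lambda>j. X (r j)) \<longlonglongrightarrow> x"
    using x(3) by (simp add: o_def)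
  have lim\<psi>: "(\<lambda>j. \<psi> (X (r j))) \<longlonglongrightarrow> \<psi> x"
    using continuous_on_tendsto_compose[OF \<psi> Xr] by simp
  have limH: "(\<lambda>j. H (X (r j))) \<longlonglongrightarrow> H x"
    using continuous_on_tendsto_compose[OF H Xr] by simp
  \<comment> \<open>Each approximate maximum is compared with the fixed competitor \<open>z\<close>.
    In the limit the strict frontier condition forces \<open>x\<close> into the interior, so
    eventually the approximate maximum points lie there too and the second derivative test applies
    to them.\<close>
  have max: "P z - \<psi> z \<le> P x - \<psi> x"
  proof (rule LIMSEQ_le)
    show "(\<lambda>j. Q (h (r j)) z - \<psi> z) \<longlonglongrightarrow> P z - \<psi> z"
      by (intro tendsto_intros limP hr hr0)
    show "(\<lambda>j. Q (h (r j)) (X (r j)) - \<psi> (X (r j))) \<longlonglongrightarrow> P x - \<psi> x"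
      by (intro tendsto_diff limP hr hr0 Xr lim\<psi>)
    show "\<exists>N. \<forall>j\<ge>N. Q (h (r j)) z - \<psi> z \<le> Q (h (r j)) (X (r j)) - \<psi> (X (r j))"
      using X(2) K(2) by blast
  qed
  then have xint: "x \<in> interior K"
    using bd x(1) by (meson DiffI leD)
  have ev: "\<forall>\<^sub>F j in sequentially. X (r j) \<in> interior K"
    using topological_tendstoD[OF Xr open_interior xint] .
  have "G x \<le> H x"
  proof (rule tendsto_le[OF sequentially_bot limH limG[OF hr hr0 Xr]])
    show "\<forall>\<^sub>F j in sequentially. G' (h (r j)) (X (r j)) \<le> H (X (r j))"
      using ev
    proof eventually_elim
      case (elim j)
      obtain E' L where L: "G' (h (r j)) (X (r j)) \<le> L"
        "has_grad_lap (Q (h (r j))) (X (r j)) E' L"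
        using jet[OF hr] by blast
      from has_grad_lap_diff[OF L(2) \<psi>jet[rule_format]]
      have "L - H (X (r j)) \<le> 0"
        by (rule has_grad_lap_max_nonpos[OF _ elim]) (use X(2) in auto)
      with L(1) show ?case by simp
    qed
  qed
  with max xint show "\<exists>x\<in>interior K. P z - \<psi> z \<le> P x - \<psi> x \<and> G x \<le> H x"
    by blast
qed

text \<open>A shallow paraboloid centred at \<open>z\<close> localises the problem: boundedness of
  \<open>P\<close> makes it win on a large sphere, while its small Laplacian contradicts coercivity
  at the touching point.\<close>

lemma visc_sub_nonpos:
  fixes P :: "real ^ 'n::finite \<Rightarrow> real"
  assumes sub: "visc_sub P G" and bdd: "\<And>x. P x \<le> M" and c: "c > 0"
    and ineq: "\<And>x. P x > 0 \<Longrightarrow> c * P x \<le> G x"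
  shows "P z \<le> 0"
proof (rule ccontr)
  assume "\<not> P z \<le> 0"
  then have z: "P z > 0" by simp
  define n where "n = real CARD('n)"
  \<comment> \<open>The paraboloid then has Laplacian
    \<open>\<delta> * (2 * n) = c * P z / 2\<close>; on the sphere of radius
    \<open>sqrt (M / \<delta>)\<close> it equals \<open>M\<close>.\<close>
  define \<delta> where "\<delta> = c * P z / (4 * n)"
  have n: "n > 0" by (simp add: n_def)
  have \<delta>: "\<delta> > 0" "\<delta> * (2 * n) < c * P z" using c z n by (auto simp: \<delta>_def)
  have M: "M > 0" using z bdd[of z] by simp
  obtain x where x: "P z - \<delta> * (norm (z - z))\<^sup>2 \<le> P x - \<delta> * (norm (x - z))\<^sup>2" "G x \<le> \<delta> * (2 * n)"
  proof (rule visc_subD[OF sub, of "cball z (sqrt (M / \<delta>))" z "\<lambda>y. \<delta> * (norm (y - z))\<^sup>2" "\<lambda>x. \<delta> * (2 * n)"])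
    show "has_grad_lap (\<lambda>y. \<delta> * (norm (y - z))\<^sup>2) x (\<lambda>i. \<delta> * (2 * (x - z) $ i)) (\<delta> * (2 * n))" for x
      unfolding n_def by (intro has_grad_lap_cmult has_grad_lap_dist_sq)
    show "P x - \<delta> * (norm (x - z))\<^sup>2 < P z - \<delta> * (norm (z - z))\<^sup>2"
      if "x \<in> cball z (sqrt (M / \<delta>)) - interior (cball z (sqrt (M / \<delta>)))" for x
      using norm_frontier_cball[OF that] z bdd[of x] \<delta> M by simp
  qed (use \<delta> M in \<open>auto intro!: continuous_intros\<close>)
  have "0 \<le> \<delta> * (norm (x - z))\<^sup>2" using \<delta> by simp
  with x(1) have "P z \<le> P x" by simp
  then have "c * P z \<le> c * P x" using c by simp
  also have "\<dots> \<le> G x" using \<open>P z \<le> P x\<close> z by (intro ineq) simp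
  finally show False using x(2) \<delta>(2) by simp
qed

lemma visc_sub_zero:
  fixes P :: "real ^ 'n::finite \<Rightarrow> real"
  assumes sub: "visc_sub P G" and zero: "\<And>x. P x = 0"
  shows "G z \<le> 0"
proof (rule field_le_epsilon)
  fix e :: real
  assume e: "e > 0"
  define \<delta> where "\<delta> = e / (2 * real CARD('n))"
  have \<delta>: "\<delta> > 0" "\<delta> * (2 * real CARD('n)) = e" using e by (auto simp: \<delta>_def)
  obtain x where x: "P z - \<delta> * (norm (z - z))\<^sup>2 \<le> P x - \<delta> * (norm (x - z))\<^sup>2" "G x \<le> e"
  proof (rule visc_subD[OF sub, of "cball z 1" z "\<lambda>y. \<delta> * (norm (y - z))\<^sup>2" "\<lambda>x. e"])
    show "has_grad_lap (\<lambda>y. \<delta> * (norm (y - z))\<^sup>2) x (\<lambda>i. \<delta> * (2 * (x - z) $ i)) e" for x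
      unfolding \<delta>(2)[symmetric] by (intro has_grad_lap_cmult has_grad_lap_dist_sq)
    show "P x - \<delta> * (norm (x - z))\<^sup>2 < P z - \<delta> * (norm (z - z))\<^sup>2"
      if "x \<in> cball z 1 - interior (cball z 1)" for x
      using norm_frontier_cball[OF that] zero \<delta> by simp
  qed (auto intro!: continuous_intros)
  \<comment> \<open>As \<open>P\<close> vanishes, the touching inequality reads
    \<open>\<delta> * (norm (x - z))\<^sup>2 \<le> 0\<close>, so the inequality for \<open>G\<close>
    is obtained at \<open>z\<close> itself.\<close>
  have "x = z"
    using x(1) zero \<delta>(1) by (simp add: mult_le_0_iff)
  then show "G z \<le> 0 + e" using x(2) by simp
qed

text \<open>Hopf's argument in viscosity form. A ball touches the zero set of \<open>P\<close> at
  the single point \<open>x1\<close>; near \<open>x1\<close> a test function vanishing on its sphere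
  satisfies \<open>\<Delta>\<psi> < 2 * \<psi>\<close>, whereas touching would give
  \<open>2 * \<psi> \<le> 2 * P \<le> G \<le> \<Delta>\<psi>\<close>.\<close>

lemma visc_sub_strong_max:
  fixes P :: "real ^ 'n::finite \<Rightarrow> real"
  assumes sub: "visc_sub P G" and cont: "continuous_on UNIV P"
    and nonpos: "\<And>x. P x \<le> 0" and ineq: "\<And>x. 2 * P x \<le> G x"
    and zero: "P w = 0"
  shows "P y0 = 0"
proof (rule ccontr)
  assume "P y0 \<noteq> 0"
  then have y0: "P y0 < 0" using nonpos[of y0] by simp
  have "closed {x. P x = 0}"
    using continuous_closed_vimage[of "{0}" P] cont
    by (auto simp: vimage_def continuous_on_eq_continuous_at)
  then obtain x1 where x1: "P x1 = 0" "\<And>x. P x = 0 \<Longrightarrow> dist y0 x1 \<le> dist y0 x"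
    using distance_attains_inf[of "{x. P x = 0}" y0] zero by auto
  \<comment> \<open>Unlike the ball of radius \<open>2 r\<close> about \<open>y0\<close>, the one of radius \<open>r\<close> about \<open>y\<close> meets
    the zero set of \<open>P\<close> only at \<open>x1\<close>.\<close>
  define y where "y = midpoint y0 x1"
  define r where "r = dist y0 x1 / 2"
  have r: "r > 0" using x1(1) y0 by (auto simp: r_def)
  have yx1: "dist x1 y = r" "dist y0 y = r"
    by (auto simp: y_def r_def dist_midpoint)
  have neg: "P x < 0" if "dist x y \<le> r" "x \<noteq> x1" for x
  proof (rule ccontr)
    assume "\<not> P x < 0"
    then have "P x = 0" using nonpos[of x] by simp
    then have le: "2 * r \<le> dist y0 x" using x1(2) by (simp add: r_def)
    have "dist y0 x \<le> dist y0 y + dist x y"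
      by (rule dist_triangle2)
    then have eq: "dist x y = r" "dist y0 x = dist y0 y + dist y x"
      using le that(1) yx1(2) by (auto simp: dist_commute)
    \<comment> \<open>Equality in the triangle inequality makes \<open>y0 - y\<close> and
      \<open>y - x\<close> parallel with the same direction. Both have length \<open>r\<close>, so
      \<open>x\<close> is the reflection of \<open>y0\<close> in the midpoint \<open>y\<close>,
      which is \<open>x1\<close>.\<close>
    have "norm ((y0 - y) + (y - x)) = norm (y0 - y) + norm (y - x)"
      using eq(2) by (simp add: dist_norm)
    then have "norm (y0 - y) *\<^sub>R (y - x) = norm (y - x) *\<^sub>R (y0 - y)"
      by (rule norm_triangle_eq[THEN iffD1])
    then have "y - x = y0 - y"
      using eq(1) yx1(2) r by (simp add: dist_norm norm_minus_commute)
    moreover have "y - x1 = y0 - y"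
      by (simp add: y_def midpoint_def algebra_simps scaleR_2[symmetric])
    ultimately show False using that(2) by (metis diff_left_imp_eq)
  qed
  define n where "n = real CARD('n)"
  \<comment> \<open>Here \<open>2 * A * r\<^sup>2 = 2 * r\<^sup>2 + 4 * n + 4\<close>, enough to
    beat \<open>4 * n + 2\<close> in the final estimate.\<close>
  define A where "A = 1 + (2 * n + 2) / r\<^sup>2"
  \<comment> \<open>The first bound keeps \<open>norm (x - y) \<ge> r / 2\<close> on the small ball;
    the second gives \<open>2 * A * \<bar>s x\<bar> \<le> 1\<close> there, since
    \<open>\<bar>s x\<bar> \<le> 3 * r * \<eta>\<close>.\<close>
  define \<eta> where "\<eta> = min (r / 2) (1 / (6 * A * r))"
  have n: "n > 0" by (simp add: n_def)
  have A: "A \<ge> 1" using n by (simp add: A_def)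
  have "A * r\<^sup>2 = r\<^sup>2 + (2 * n + 2)"
    using r by (simp add: A_def field_simps)
  then have Ar: "4 * n + 2 < 2 * A * r\<^sup>2"
    using zero_le_power2[of r] by linarith
  have \<eta>: "\<eta> > 0" "\<eta> \<le> r / 2" "6 * A * r * \<eta> \<le> 1"
  proof -
    show "\<eta> > 0" "\<eta> \<le> r / 2" using r A by (auto simp: \<eta>_def)
    have "\<eta> \<le> 1 / (6 * A * r)" by (simp add: \<eta>_def)
    then show "6 * A * r * \<eta> \<le> 1"
      using r A by (simp add: pos_le_divide_eq mult.commute)
  qed
  define s where "s = (\<lambda>x. (norm (x - y))\<^sup>2 - r\<^sup>2)"
  have near: "2 * A * \<bar>s x\<bar> \<le> 1" "r\<^sup>2 / 4 \<le> (norm (x - y))\<^sup>2" if "x \<in> cball x1 \<eta>" for x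
  proof -
    have d: "dist x x1 \<le> \<eta>" using that by (simp add: dist_commute)
    have 1: "dist x y \<le> r + \<eta>" "r - \<eta> \<le> dist x y"
      using dist_triangle[of x y x1] dist_triangle[of x1 y x] d yx1(1) by (auto simp: dist_commute)
    have "\<bar>s x\<bar> = \<bar>dist x y - r\<bar> * (dist x y + r)"
    proof -
      have "s x = (dist x y - r) * (dist x y + r)"
        by (simp add: s_def dist_norm power2_eq_square algebra_simps)
      moreover have "\<bar>dist x y + r\<bar> = dist x y + r" using r by simp
      ultimately show ?thesis by (simp add: abs_mult)
    qed
    also have "\<dots> \<le> \<eta> * (3 * r)"
      using 1 \<eta> r by (intro mult_mono) auto
    finally have "2 * A * \<bar>s x\<bar> \<le> 2 * A * (\<eta> * (3 * r))"
      using A by (intro mult_left_mono) auto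
    also have "\<dots> \<le> 1" using \<eta>(3) by (simp add: algebra_simps)
    finally show "2 * A * \<bar>s x\<bar> \<le> 1" .
    have "(r / 2)\<^sup>2 \<le> (norm (x - y))\<^sup>2"
      using 1 \<eta> r by (intro power_mono) (auto simp: dist_norm)
    then show "r\<^sup>2 / 4 \<le> (norm (x - y))\<^sup>2" by (simp add: power_divide)
  qed
  \<comment> \<open>The small sphere misses \<open>x1\<close>, so \<open>P\<close> is negative on
    its compact part inside the closed ball and bounded away from 0 there; if that part is empty,
    any positive value serves.\<close>
  obtain \<mu> where \<mu>: "\<mu> > 0" "\<And>x. x \<in> sphere x1 \<eta> \<Longrightarrow> dist x y \<le> r \<Longrightarrow> P x \<le> - \<mu>"
  proof (cases "sphere x1 \<eta> \<inter> cball y r = {}")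
    case True
    have "x \<in> cball y r" if "dist x y \<le> r" for x
      using that by (simp add: dist_commute)
    with True show thesis by (intro that[of 1]) auto
  next
    case False
    have "compact (sphere x1 \<eta> \<inter> cball y r)" by auto
    then obtain m where m: "m \<in> sphere x1 \<eta> \<inter> cball y r" "\<And>x. x \<in> sphere x1 \<eta> \<inter> cball y r \<Longrightarrow> P x \<le> P m"
      using continuous_attains_sup[OF _ False continuous_on_subset[OF cont]] by blast
    have "P m < 0" using m(1) \<eta>(1) by (intro neg) (auto simp: dist_commute)
    then show thesis
      using m(2) by (intro that[of "- P m"]) (auto simp: dist_commute)
  qed
  \<comment> \<open>Near \<open>x1\<close> this test function has the sign of \<open>s\<close>, and \<open>\<Delta>\<psi> < 2 \<psi>\<close> because \<open>A\<close> is large.\<close>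
  define \<psi> where "\<psi> = (\<lambda>x. \<mu> / 2 * (s x - A * (s x)\<^sup>2))"
  define H where "H = (\<lambda>x. \<mu> / 2 * ((1 - 2 * A * s x) * (2 * n) - 8 * A * (norm (x - y))\<^sup>2))"
  have \<psi>jet: "has_grad_lap \<psi> x (\<lambda>i. \<mu> / 2 * ((1 - 2 * A * s x) * (2 * (x - y) $ i))) (H x)" for x
  proof -
    have sx: "has_grad_lap s x (\<lambda>i. 2 * (x - y) $ i) (2 * n)"
      using has_grad_lap_diff[OF has_grad_lap_dist_sq[where x = x and z = y] has_grad_lap_const[of "r\<^sup>2"]]
      by (simp add: s_def n_def)
    have "(\<Sum>i\<in>UNIV. (2 * (x - y) $ i)\<^sup>2) = 4 * (norm (x - y))\<^sup>2"
      by (rule sum_double_component_sq)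
    moreover have "has_grad_lap (\<lambda>x. \<mu> / 2 * (s x - A * (s x)\<^sup>2)) x
      (\<lambda>i. \<mu> / 2 * ((1 - 2 * A * s x) * (2 * (x - y) $ i)))
      (\<mu> / 2 * ((1 - 2 * A * s x) * (2 * n) + (- 2 * A) * (\<Sum>i\<in>UNIV. (2 * (x - y) $ i)\<^sup>2)))"
      by (intro has_grad_lap_cmult, rule has_grad_lap_chain[OF sx,
          where h = "\<lambda>s. s - A * s\<^sup>2" and h' = "\<lambda>s. 1 - 2 * A * s"])
        (auto intro!: derivative_eq_intros always_eventually)
    ultimately show ?thesis
      by (simp add: \<psi>_def H_def mult.assoc)
  qed
  have \<psi>eq: "\<psi> x = \<mu> / 2 * (s x * (1 - A * s x))" for x
    by (simp add: \<psi>_def power2_eq_square algebra_simps)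
  have s1: "s x1 = 0" using yx1(1) by (simp add: s_def dist_norm)
  have \<psi>1: "\<psi> x1 = 0" using s1 by (simp add: \<psi>_def)
  have As: "\<bar>A * s x\<bar> \<le> 1 / 2" if "x \<in> cball x1 \<eta>" for x
    using near(1)[OF that] A by (simp add: abs_mult)
  have s2: "\<bar>s x\<bar> \<le> 1 / 2" if "x \<in> cball x1 \<eta>" for x
  proof -
    have "1 * \<bar>s x\<bar> \<le> A * \<bar>s x\<bar>" using A by (intro mult_right_mono) auto
    then show ?thesis using near(1)[OF that] by simp
  qed
  have lower: "- 3 / 4 \<le> s x * (1 - A * s x)" if "x \<in> cball x1 \<eta>" for x
  proof -
    have "\<bar>s x * (1 - A * s x)\<bar> \<le> 1 / 2 * (3 / 2)"
      unfolding abs_mult using As[OF that] s2[OF that] by (intro mult_mono) auto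
    then show ?thesis by linarith
  qed
  obtain x where x: "x \<in> interior (cball x1 \<eta>)" "P x1 - \<psi> x1 \<le> P x - \<psi> x" "G x \<le> H x"
  proof (rule visc_subD[OF sub _ _ _ _ \<psi>jet, of "cball x1 \<eta>" x1])
    show "continuous_on UNIV \<psi>" "continuous_on UNIV H"
      unfolding \<psi>_def H_def s_def by (intro continuous_intros)+
    fix x assume x: "x \<in> cball x1 \<eta> - interior (cball x1 \<eta>)"
    then have xs: "x \<in> sphere x1 \<eta>" "x \<in> cball x1 \<eta>"
      by auto
    \<comment> \<open>Inside the ball about \<open>y\<close>, \<open>P \<le> - \<mu>\<close> beats
      \<open>\<psi> \<ge> - 3 * \<mu> / 8\<close>; outside it
      \<open>P \<le> 0 < \<psi>\<close>.\<close>
    have "P x - \<psi> x < 0"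
    proof (cases "dist x y \<le> r")
      case True
      have "\<mu> / 2 * (- 3 / 4) \<le> \<psi> x"
        unfolding \<psi>eq using \<mu>(1) lower[OF xs(2)] by (intro mult_left_mono) auto
      then show ?thesis using \<mu>(2)[OF xs(1) True] \<mu>(1) by simp
    next
      case False
      then have "r\<^sup>2 < (norm (x - y))\<^sup>2"
        using r by (intro power_strict_mono) (auto simp: dist_norm)
      then have "s x * (1 - A * s x) > 0"
        using As[OF xs(2)] by (intro mult_pos_pos) (auto simp: s_def)
      then have "\<psi> x > 0" unfolding \<psi>eq using \<mu>(1) by simp
      then show ?thesis using nonpos[of x] by simp
    qed
    then show "P x - \<psi> x < P x1 - \<psi> x1"
      using \<psi>1 x1(1) by simp
  qed (use \<eta> in auto)
  have xc: "x \<in> cball x1 \<eta>" using x(1) interior_subset by blast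
  have "2 * \<psi> x \<le> 2 * P x" using x(2) \<psi>1 x1(1) by simp
  also have "\<dots> \<le> H x" using ineq[of x] x(3) by simp
  finally have "\<mu> / 2 * (2 * (s x * (1 - A * s x)))
      \<le> \<mu> / 2 * ((1 - 2 * A * s x) * (2 * n) - 8 * A * (norm (x - y))\<^sup>2)"
    by (simp add: \<psi>eq H_def)
  then have *: "2 * (s x * (1 - A * s x)) \<le> (1 - 2 * A * s x) * (2 * n) - 8 * A * (norm (x - y))\<^sup>2"
    using \<mu>(1) by (subst (asm) mult_le_cancel_left_pos) auto
  \<comment> \<open>Together these bound the right side of \<open>*\<close> by
    \<open>4 * n - 2 * A * r\<^sup>2 < - 2\<close>, while its left side is at least
    \<open>- 3 / 2\<close>.\<close>
  have "(1 - 2 * A * s x) * (2 * n) \<le> 2 * (2 * n)"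
    using As[OF xc] n by (intro mult_right_mono) (auto simp: abs_le_iff)
  moreover have "8 * A * (r\<^sup>2 / 4) \<le> 8 * A * (norm (x - y))\<^sup>2"
    using near(2)[OF xc] A by (intro mult_left_mono) auto
  ultimately show False
    using * lower[OF xc] Ar by linarith
qed

section \<open>Partial derivatives and difference quotients\<close>

lemma has_vector_derivative_line:
  assumes "(f has_derivative f') (at (x + t *\<^sub>R e))"
  shows "((\<lambda>s. f (x + s *\<^sub>R e)) has_vector_derivative f' e) (at t)"
proof -
  have "((\<lambda>s. x + s *\<^sub>R e) has_vector_derivative e) (at t)"
    by (auto intro!: derivative_eq_intros)
  from vector_derivative_diff_chain_within[OF this has_derivative_at_withinI[OF assms]]
  show ?thesis by (simp add: o_def)
qed

lemma partial_deriv_eq: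
  assumes "(f has_derivative f') (at x)"
  shows "partial_deriv i f x = f' (axis i 1)"
  unfolding partial_deriv_def
  by (rule vector_derivative_at, rule has_vector_derivative_line) (use assms in simp)

lemma C1_fun_has_partial_deriv:
  assumes "C1_fun f"
  shows "((\<lambda>s. f (x + s *\<^sub>R axis i 1)) has_vector_derivative partial_deriv i f (x + t *\<^sub>R axis i 1)) (at t)"
proof -
  obtain f' where "(f has_derivative f') (at (x + t *\<^sub>R axis i 1))"
    using assms unfolding C1_fun_def differentiable_def by blast
  then show ?thesis
    using has_vector_derivative_line partial_deriv_eq by metis
qed

lemma C1_fun_continuous: "C1_fun f \<Longrightarrow> continuous_on UNIV f"
  by (simp add: C1_fun_def continuous_on_eq_continuous_at differentiable_imp_continuous_within)

lemma C1_fun_continuous_partial_deriv: "C1_fun f \<Longrightarrow> continuous_on UNIV (partial_deriv i f)"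
  by (simp add: C1_fun_def)

lemma C2_fun_has_grad_lap:
  assumes "C2_fun f"
  shows "has_grad_lap f x (\<lambda>i. partial_deriv i f x) (\<Sum>i\<in>UNIV. partial_deriv i (partial_deriv i f) x)"
proof -
  have "has_line_derivs f (axis i 1) x (partial_deriv i f x) (partial_deriv i (partial_deriv i f) x)" for i
    unfolding has_line_derivs_def
  proof (intro exI[of _ "\<lambda>t. partial_deriv i f (x + t *\<^sub>R axis i 1)"] conjI)
    show "\<forall>\<^sub>F t in nhds 0. ((\<lambda>s. f (x + s *\<^sub>R axis i 1))
        has_vector_derivative partial_deriv i f (x + t *\<^sub>R axis i 1)) (at t)"
      using assms by (intro always_eventually allI C1_fun_has_partial_deriv) (simp add: C2_fun_def)
    show "((\<lambda>t. partial_deriv i f (x + t *\<^sub>R axis i 1))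
        has_vector_derivative partial_deriv i (partial_deriv i f) x) (at 0)"
      using C1_fun_has_partial_deriv[of "partial_deriv i f" x i 0] assms by (simp add: C2_fun_def)
  qed simp
  then show ?thesis
    unfolding has_grad_lap_def
    by (intro exI[of _ "\<lambda>i. partial_deriv i (partial_deriv i f) x"]) simp
qed

lemma partial_deriv_component:
  assumes "C1_fun f"
  shows "partial_deriv i (\<lambda>y. f y $ k) = (\<lambda>x. partial_deriv i f x $ k)"
proof
  fix x
  have "((\<lambda>s. f (x + s *\<^sub>R axis i 1) $ k) has_vector_derivative partial_deriv i f (x + 0 *\<^sub>R axis i 1) $ k) (at 0)"
    by (rule bounded_linear.has_vector_derivative[OF bounded_linear_vec_nth C1_fun_has_partial_deriv[OF assms]])
  then show "partial_deriv i (\<lambda>y. f y $ k) x = partial_deriv i f x $ k"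
    unfolding partial_deriv_def by (simp add: vector_derivative_at)
qed

lemma vec_laplacian_eq:
  assumes "C2_fun f"
  shows "vec_laplacian f x = (\<Sum>i\<in>UNIV. partial_deriv i (partial_deriv i f) x)"
  using assms
  by (simp add: vec_laplacian_def laplacian_def partial_deriv_component C2_fun_def vec_eq_iff)

text \<open>The base point moves with the step, so differentiability at \<open>x\<close> alone does
  not suffice. The mean value theorem, applied to each component, turns the quotient into a partial
  derivative at a nearby point, and continuity finishes.\<close>

lemma C1_fun_difference_quotient_tendsto:
  fixes f :: "real ^ 'n::finite \<Rightarrow> real ^ 'm::finite"
  assumes "C1_fun f" "\<And>j. h j > 0" "h \<longlonglongrightarrow> 0" "X \<longlonglongrightarrow> x"
  shows "(\<lambda>j::nat. (1 / h j) *\<^sub>R (f (h j *\<^sub>R axis i 1 + X j) - f (X j))) \<longlonglongrightarrow> partial_deriv i f x"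
proof (rule vec_tendstoI)
  fix k
  have "\<exists>z. 0 < z \<and> z < h j \<and>
      f (X j + h j *\<^sub>R axis i 1) $ k - f (X j + 0 *\<^sub>R axis i 1) $ k =
      (h j - 0) * partial_deriv i f (X j + z *\<^sub>R axis i 1) $ k" for j
    by (rule MVT2[of 0 "h j" "\<lambda>t. f (X j + t *\<^sub>R axis i 1) $ k"])
      (use assms(2) bounded_linear.has_vector_derivative[OF bounded_linear_vec_nth
          C1_fun_has_partial_deriv[OF assms(1)]] in
        \<open>auto simp: has_real_derivative_iff_has_vector_derivative\<close>)
  then obtain z where z: "\<And>j. 0 < z j" "\<And>j. z j < h j"
      "\<And>j. f (X j + h j *\<^sub>R axis i 1) $ k - f (X j) $ k =
        h j * partial_deriv i f (X j + z j *\<^sub>R axis i 1) $ k"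
    by (simp, metis)
  have "z \<longlonglongrightarrow> 0"
    using tendsto_sandwich[of "\<lambda>_. 0" z sequentially h 0] z(1,2) assms(3)
    by (auto intro: less_imp_le always_eventually)
  then have "(\<lambda>j. X j + z j *\<^sub>R axis i 1) \<longlonglongrightarrow> x + 0 *\<^sub>R axis i 1"
    by (intro tendsto_intros assms(4))
  then have "(\<lambda>j. partial_deriv i f (X j + z j *\<^sub>R axis i 1)) \<longlonglongrightarrow> partial_deriv i f x"
    using continuous_on_tendsto_compose[OF C1_fun_continuous_partial_deriv[OF assms(1)]] by simp
  then have "(\<lambda>j. partial_deriv i f (X j + z j *\<^sub>R axis i 1) $ k) \<longlonglongrightarrow> partial_deriv i f x $ k"
    by (rule tendsto_vec_nth)
  moreover have "((1 / h j) *\<^sub>R (f (h j *\<^sub>R axis i 1 + X j) - f (X j))) $ k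
      = partial_deriv i f (X j + z j *\<^sub>R axis i 1) $ k" for j
    using z(3)[of j] assms(2)[of j] by (simp add: add.commute)
  ultimately show "(\<lambda>j. ((1 / h j) *\<^sub>R (f (h j *\<^sub>R axis i 1 + X j) - f (X j))) $ k)
      \<longlonglongrightarrow> partial_deriv i f x $ k"
    by simp
qed

lemma constant_on_partial_deriv_zero:
  fixes f :: "real ^ 'n::finite \<Rightarrow> 'b::real_normed_vector"
  assumes diff: "\<And>x. f differentiable (at x)" and zero: "\<And>i x. partial_deriv i f x = 0"
  shows "f constant_on UNIV"
proof -
  have "(f has_derivative (\<lambda>h. 0)) (at x)" for x
  proof -
    obtain f' where f': "(f has_derivative f') (at x)"
      using diff unfolding differentiable_def by blast
    have "f' v = 0" for v
    proof -
      have "linear f'" using f' has_derivative_linear by blast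
      have "f' v = f' (\<Sum>i\<in>UNIV. v $ i *\<^sub>R axis i 1)"
        using basis_expansion[of v] by (simp add: scalar_mult_eq_scaleR)
      also have "\<dots> = (\<Sum>i\<in>UNIV. v $ i *\<^sub>R f' (axis i 1))"
        using \<open>linear f'\<close> by (simp add: linear_sum linear_scale)
      also have "\<dots> = 0"
        using zero partial_deriv_eq[OF f'] by simp
      finally show ?thesis .
    qed
    then have "f' = (\<lambda>h. 0)" by auto
    with f' show ?thesis by simp
  qed
  then obtain c where "\<And>x. f x = c"
    using has_derivative_zero_constant[of UNIV f] by auto
  then show ?thesis by (auto simp: constant_on_def)
qed

section \<open>Entire solutions of the Ginzburg--Landau system\<close>

locale ginzburg_landau =
  fixes u :: "real ^ 'n::finite \<Rightarrow> real ^ 'm::finite"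
  assumes C2: "C2_fun u"
    and eq: "\<And>x. vec_laplacian u x = ((norm (u x))\<^sup>2 - 1) *\<^sub>R u x"
begin

definition P :: "real \<Rightarrow> real ^ 'n \<Rightarrow> real" where
  "P a x = 1/2 * (grad_norm_sq u x - a * (1 - (norm (u x))\<^sup>2))"

text \<open>
  \<open>G a\<close> is \<open>\<Delta>(P a)\<close>, computed formally, with the term \<open>|D\<^sup>2u|\<^sup>2\<close> dropped.
\<close>

definition G :: "real \<Rightarrow> real ^ 'n \<Rightarrow> real" where
  "G a x = ((norm (u x))\<^sup>2 - 1 + a) * grad_norm_sq u x
    + 2 * (\<Sum>i\<in>UNIV. (partial_deriv i u x \<bullet> u x)\<^sup>2) - a * (norm (u x))\<^sup>2 * (1 - (norm (u x))\<^sup>2)"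

section \<open>Regularity and bounds for the solution\<close>

lemma C1: "C1_fun u"
  using C2 by (simp add: C2_fun_def)

lemma cont: "continuous_on UNIV u"
  by (rule C1_fun_continuous[OF C1])

lemma jet: "has_grad_lap u x (\<lambda>i. partial_deriv i u x) (((norm (u x))\<^sup>2 - 1) *\<^sub>R u x)"
  using C2_fun_has_grad_lap[OF C2] eq vec_laplacian_eq[OF C2] by simp

lemma jet_norm_sq:
  "has_grad_lap (\<lambda>x. (norm (u x))\<^sup>2) x (\<lambda>i. 2 * (u x \<bullet> partial_deriv i u x))
    (2 * grad_norm_sq u x - 2 * (norm (u x))\<^sup>2 * (1 - (norm (u x))\<^sup>2))"
  using has_grad_lap_norm_sq[OF jet, of x]
  by (simp add: grad_norm_sq_def power2_norm_eq_inner algebra_simps)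

lemma grad_norm_sq_nonneg: "0 \<le> grad_norm_sq u x"
  by (simp add: grad_norm_sq_def sum_nonneg)

lemma norm_le_1: "norm (u x) \<le> 1"
proof -
  have "(norm (u x))\<^sup>2 - 1 \<le> 0"
  proof (rule keller_osserman_nonpos[where f = "\<lambda>x. (norm (u x))\<^sup>2 - 1"])
    show "continuous_on UNIV (\<lambda>x. (norm (u x))\<^sup>2 - 1)"
      by (intro continuous_intros cont)
    show "has_grad_lap (\<lambda>x. (norm (u x))\<^sup>2 - 1) x (\<lambda>i. 2 * (u x \<bullet> partial_deriv i u x))
      (2 * grad_norm_sq u x - 2 * (norm (u x))\<^sup>2 * (1 - (norm (u x))\<^sup>2))" for x
      using has_grad_lap_diff[OF jet_norm_sq has_grad_lap_const[of 1]] by simp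
    \<comment> \<open>With \<open>w = (norm (u x))\<^sup>2 - 1\<close> the right side is at least
      \<open>2 * (w + 1) * w = 2 * w\<^sup>2 + 2 * w\<close>.\<close>
    show "2 * ((norm (u x))\<^sup>2 - 1)\<^sup>2
        \<le> 2 * grad_norm_sq u x - 2 * (norm (u x))\<^sup>2 * (1 - (norm (u x))\<^sup>2)"
      if "(norm (u x))\<^sup>2 - 1 > 0" for x
      using that grad_norm_sq_nonneg[of x] by (simp add: power2_eq_square algebra_simps)
  qed
  then show ?thesis by (simp add: power_le_one_iff)
qed

lemma norm_sq_le_1: "(norm (u x))\<^sup>2 \<le> 1"
  using norm_le_1 by (simp add: power_le_one_iff)

text \<open>Each component of \<open>u\<close> and its Laplacian are bounded by 1, so the scalar
  gradient bound applies. The result supplies the upper bound on \<open>P a\<close> that the maximum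
  principle on the whole space requires.\<close>

lemma grad_norm_sq_bounded: "grad_norm_sq u x \<le> 4 * real CARD('n) * real CARD('m)"
proof -
  have comp: "\<bar>partial_deriv i u x $ k\<bar> \<le> 2" for i k x
  proof (rule gradient_bound[of "\<lambda>x. u x $ k" "\<lambda>x i. partial_deriv i u x $ k"
        "\<lambda>x. (((norm (u x))\<^sup>2 - 1) *\<^sub>R u x) $ k"])
    show "continuous_on UNIV (\<lambda>x. u x $ k)"
      by (intro continuous_intros cont)
    show "has_grad_lap (\<lambda>x. u x $ k) x (\<lambda>i. partial_deriv i u x $ k)
        ((((norm (u x))\<^sup>2 - 1) *\<^sub>R u x) $ k)" for x
      by (rule has_grad_lap_linear[OF bounded_linear_vec_nth jet])
    show uk: "\<bar>u x $ k\<bar> \<le> 1" for x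
      using component_le_norm_cart[of "u x" k] norm_le_1[of x] by linarith
    show "\<bar>(((norm (u x))\<^sup>2 - 1) *\<^sub>R u x) $ k\<bar> \<le> 1" for x
    proof -
      have "\<bar>(norm (u x))\<^sup>2 - 1\<bar> \<le> 1" using norm_sq_le_1[of x] by simp
      then have "\<bar>(norm (u x))\<^sup>2 - 1\<bar> * \<bar>u x $ k\<bar> \<le> 1 * 1"
        by (intro mult_mono uk) auto
      then show ?thesis by (simp add: abs_mult)
    qed
  qed
  have "(norm (partial_deriv i u x))\<^sup>2 \<le> 4 * real CARD('m)" for i
  proof -
    have "(partial_deriv i u x $ k)\<^sup>2 \<le> 4" for k
      using power_mono[OF comp[of i x k], of 2] by simp
    then have "(\<Sum>k\<in>UNIV. (partial_deriv i u x $ k)\<^sup>2) \<le> (\<Sum>k\<in>(UNIV::'m set). 4)"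
      by (intro sum_mono) auto
    then show ?thesis by (simp add: sum_component_sq)
  qed
  then have "grad_norm_sq u x \<le> (\<Sum>i\<in>(UNIV::'n set). 4 * real CARD('m))"
    unfolding grad_norm_sq_def by (intro sum_mono) auto
  then show ?thesis by simp
qed

lemma visc_sub_P:
  assumes a: "a \<ge> 0"
  shows "visc_sub (P a) (G a)"
proof -
  define v where "v = (\<lambda>h i x. u (h *\<^sub>R axis i 1 + x))"
  define d where "d = (\<lambda>h i x. (1 / h) *\<^sub>R (v h i x - u x))"
  \<comment> \<open>\<open>W\<close> is the exact Laplacian of
    \<open>a / 2 * (norm (u x))\<^sup>2\<close>: only the gradient term of \<open>P a\<close> is
    replaced by difference quotients, since \<open>u\<close> itself already has a Laplacian.\<close>
  define W where "W = (\<lambda>x. a * (grad_norm_sq u x - (norm (u x))\<^sup>2 * (1 - (norm (u x))\<^sup>2)))"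
  define Q where "Q = (\<lambda>h x. 1/2 * ((\<Sum>i\<in>UNIV. (norm (d h i x))\<^sup>2) - a * (1 - (norm (u x))\<^sup>2)))"
  define G' where "G' = (\<lambda>h x. (\<Sum>i\<in>UNIV. ((norm (v h i x))\<^sup>2 - 1) * (norm (d h i x))\<^sup>2
      + (d h i x \<bullet> (u x + v h i x)) * (d h i x \<bullet> u x)) + W x)"
  have contW: "continuous_on UNIV W"
    unfolding W_def grad_norm_sq_def
    by (intro continuous_intros cont C1_fun_continuous_partial_deriv C1)
  show ?thesis
  proof (rule visc_sub_limit)
    fix h :: real assume h: "h > 0"
    show "continuous_on UNIV (Q h)"
      unfolding Q_def d_def v_def
      by (intro continuous_intros cont continuous_on_compose2[OF cont]) auto
    fix x
    define L where "L = (\<lambda>i. (1 / h) *\<^sub>R (((norm (v h i x))\<^sup>2 - 1) *\<^sub>R v h i x - ((norm (u x))\<^sup>2 - 1) *\<^sub>R u x))"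
    have "\<exists>D. has_grad_lap (d h i) x D (L i)" for i
      unfolding d_def v_def L_def
      by (intro exI, rule has_grad_lap_linear[where T = "\<lambda>v. (1 / h) *\<^sub>R v",
          OF bounded_linear_scaleR_right has_grad_lap_diff[OF has_grad_lap_shift[OF jet] jet]])
    then obtain D where D: "\<And>i. has_grad_lap (d h i) x (D i) (L i)" by metis
    have "\<exists>E. has_grad_lap (Q h) x E
        (1/2 * ((\<Sum>i\<in>UNIV. 2 * (\<Sum>k\<in>UNIV. (norm (D i k))\<^sup>2) + 2 * (d h i x \<bullet> L i))
        - a * (0 - (2 * grad_norm_sq u x - 2 * (norm (u x))\<^sup>2 * (1 - (norm (u x))\<^sup>2)))))"
      unfolding Q_def
      by (rule exI, rule has_grad_lap_cmult, rule has_grad_lap_diff, rule has_grad_lap_sum,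
          rule has_grad_lap_norm_sq[OF D], rule has_grad_lap_cmult,
          rule has_grad_lap_diff[OF has_grad_lap_const jet_norm_sq])
    \<comment> \<open>A discrete product rule for \<open>((norm u)\<^sup>2 - 1) *\<^sub>R u\<close>:
      with \<open>v = u + h *\<^sub>R d\<close>, the increment of the squared norm is exactly
      \<open>h * (d \<bullet> (u + v))\<close>, whose quotient by \<open>h\<close> tends to twice
      the product of \<open>u\<close> and its partial derivative.\<close>
    moreover have dL: "d h i x \<bullet> L i = ((norm (v h i x))\<^sup>2 - 1) * (norm (d h i x))\<^sup>2
      + (d h i x \<bullet> (u x + v h i x)) * (d h i x \<bullet> u x)" for i
    proof -
      have v: "v h i x = u x + h *\<^sub>R d h i x" using h by (simp add: d_def)
      have "(norm (v h i x))\<^sup>2 - (norm (u x))\<^sup>2 = h * (d h i x \<bullet> (u x + v h i x))"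
        by (simp only: v power2_norm_eq_inner inner_add_left inner_add_right inner_scaleR_left
            inner_scaleR_right inner_commute[of "u x" "d h i x"])
          (simp add: algebra_simps)
      moreover have "L i = ((norm (v h i x))\<^sup>2 - 1) *\<^sub>R d h i x
          + (1 / h * ((norm (v h i x))\<^sup>2 - (norm (u x))\<^sup>2)) *\<^sub>R u x"
        by (simp add: L_def d_def algebra_simps)
      ultimately have "L i = ((norm (v h i x))\<^sup>2 - 1) *\<^sub>R d h i x + (d h i x \<bullet> (u x + v h i x)) *\<^sub>R u x"
        using h by simp
      then show ?thesis
        by (simp only: inner_add_right inner_scaleR_right power2_norm_eq_inner)
    qed
    \<comment> \<open>Only the nonnegative sum of the \<open>(norm (D i k))\<^sup>2\<close>, the
      discrete form of \<open>|D\<^sup>2u|\<^sup>2\<close>, is discarded.\<close>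
    moreover have "G' h x \<le> 1/2 * ((\<Sum>i\<in>UNIV. 2 * (\<Sum>k\<in>UNIV. (norm (D i k))\<^sup>2) + 2 * (d h i x \<bullet> L i))
        - a * (0 - (2 * grad_norm_sq u x - 2 * (norm (u x))\<^sup>2 * (1 - (norm (u x))\<^sup>2))))"
    proof -
      have "0 \<le> (\<Sum>i\<in>UNIV. \<Sum>k\<in>UNIV. (norm (D i k))\<^sup>2)"
        by (intro sum_nonneg) auto
      moreover have "G' h x = (\<Sum>i\<in>UNIV. d h i x \<bullet> L i) + W x"
        by (simp only: G'_def dL)
      ultimately show ?thesis
        by (simp add: W_def sum.distrib sum_distrib_left[symmetric] algebra_simps)
    qed
    ultimately show "\<exists>E. \<exists>L\<ge>G' h x. has_grad_lap (Q h) x E L" by blast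
  next
    fix h :: "nat \<Rightarrow> real" and X :: "nat \<Rightarrow> real ^ 'n" and x
    assume h: "\<And>j. h j > 0" "h \<longlonglongrightarrow> 0" and X: "X \<longlonglongrightarrow> x"
    have lu: "(\<lambda>j. u (X j)) \<longlonglongrightarrow> u x"
      using continuous_on_tendsto_compose[OF cont X] by simp
    have ld: "(\<lambda>j. d (h j) i (X j)) \<longlonglongrightarrow> partial_deriv i u x" for i
      unfolding d_def v_def by (rule C1_fun_difference_quotient_tendsto[OF C1 h X])
    have lv: "(\<lambda>j. v (h j) i (X j)) \<longlonglongrightarrow> u x" for i
    proof -
      have "(\<lambda>j. h j *\<^sub>R axis i 1 + X j) \<longlonglongrightarrow> 0 *\<^sub>R axis i 1 + x"
        by (intro tendsto_intros h X)
      then show ?thesis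
        unfolding v_def using continuous_on_tendsto_compose[OF cont] by simp
    qed
    have lW: "(\<lambda>j. W (X j)) \<longlonglongrightarrow> W x"
      using continuous_on_tendsto_compose[OF contW X] by simp
    show "(\<lambda>j. Q (h j) (X j)) \<longlonglongrightarrow> P a x"
      unfolding Q_def P_def grad_norm_sq_def by (intro tendsto_intros lu ld)
    have "(\<lambda>j. G' (h j) (X j)) \<longlonglongrightarrow> (\<Sum>i\<in>UNIV. ((norm (u x))\<^sup>2 - 1) * (norm (partial_deriv i u x))\<^sup>2
      + (partial_deriv i u x \<bullet> (u x + u x)) * (partial_deriv i u x \<bullet> u x)) + W x"
      unfolding G'_def by (intro tendsto_intros lu ld lv lW)
    moreover have "(\<Sum>i\<in>UNIV. ((norm (u x))\<^sup>2 - 1) * (norm (partial_deriv i u x))\<^sup>2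
      + (partial_deriv i u x \<bullet> (u x + u x)) * (partial_deriv i u x \<bullet> u x)) + W x = G a x"
    proof -
      have "(partial_deriv i u x \<bullet> (u x + u x)) * (partial_deriv i u x \<bullet> u x)
          = 2 * (partial_deriv i u x \<bullet> u x)\<^sup>2" for i
        by (simp only: inner_add_right power2_eq_square) (simp add: algebra_simps)
      then have "(\<Sum>i\<in>UNIV. ((norm (u x))\<^sup>2 - 1) * (norm (partial_deriv i u x))\<^sup>2
          + (partial_deriv i u x \<bullet> (u x + u x)) * (partial_deriv i u x \<bullet> u x))
          = ((norm (u x))\<^sup>2 - 1) * grad_norm_sq u x + 2 * (\<Sum>i\<in>UNIV. (partial_deriv i u x \<bullet> u x)\<^sup>2)"
        by (simp only: grad_norm_sq_def sum.distrib sum_distrib_left)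
      then show ?thesis
        by (simp add: G_def W_def algebra_simps)
    qed
    ultimately show "(\<lambda>j. G' (h j) (X j)) \<longlonglongrightarrow> G a x" by simp
  qed
qed

text \<open>Regroups \<open>G a\<close> around \<open>P a\<close>. For \<open>a > 1\<close> and
  \<open>P a > 0\<close> the coefficient of \<open>P a\<close> is at least
  \<open>2 * (a - 1)\<close> and the rest is nonnegative; for \<open>a = 1\<close> the middle term
  disappears.\<close>

lemma G_ge: "2 * ((norm (u x))\<^sup>2 + (a - 1)) * P a x + a * (a - 1) * (1 - (norm (u x))\<^sup>2)
    + 2 * (\<Sum>i\<in>UNIV. (partial_deriv i u x \<bullet> u x)\<^sup>2) = G a x"
  by (simp add: G_def P_def algebra_simps)

lemma P_nonpos: "P 1 x \<le> 0"
proof -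
  \<comment> \<open>The shift by \<open>e\<close> keeps the coefficient of \<open>P\<close> at least
    \<open>2 * e\<close> even where \<open>u\<close> vanishes, which gives the coercivity the
    maximum principle needs.\<close>
  have step: "P (1 + e) x \<le> 0" if e: "e > 0" for e
  proof (rule visc_sub_nonpos[OF visc_sub_P])
    show "P (1 + e) x \<le> 1/2 * (4 * real CARD('n) * real CARD('m))" for x
    proof -
      have "0 \<le> (1 + e) * (1 - (norm (u x))\<^sup>2)"
        using e norm_sq_le_1[of x] by simp
      then show ?thesis
        using grad_norm_sq_bounded[of x] unfolding P_def by (intro mult_left_mono) linarith+
    qed
    show "2 * e * P (1 + e) x \<le> G (1 + e) x" if "P (1 + e) x > 0" for x
    proof -
      have "0 \<le> (1 + e) * e * (1 - (norm (u x))\<^sup>2)"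
        using e norm_sq_le_1[of x] by simp
      moreover have "0 \<le> 2 * (\<Sum>i\<in>UNIV. (partial_deriv i u x \<bullet> u x)\<^sup>2)"
        by (simp add: sum_nonneg)
      moreover have "2 * e * P (1 + e) x \<le> 2 * ((norm (u x))\<^sup>2 + e) * P (1 + e) x"
        using that by (intro mult_right_mono) auto
      ultimately show ?thesis
        using G_ge[of x "1 + e"] by simp
    qed
  qed (use e in auto)
  have "((\<lambda>e. P (1 + e) x) \<longlongrightarrow> P (1 + 0) x) (at_right 0)"
    unfolding P_def by (intro tendsto_intros)
  moreover have "\<forall>\<^sub>F e::real in at_right 0. e > 0"
    by (simp add: eventually_at_right_less)
  then have "\<forall>\<^sub>F e in at_right 0. P (1 + e) x \<le> 0"
    by eventually_elim (rule step)
  ultimately show ?thesis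
    using tendsto_upperbound[of "\<lambda>e. P (1 + e) x" "P (1 + 0) x" "at_right 0" 0] by simp
qed

lemma P_zero_imp_constant:
  assumes zero: "\<And>x. P 1 x = 0"
  shows "u constant_on UNIV"
proof -
  have grad: "grad_norm_sq u x = 1 - (norm (u x))\<^sup>2" for x
    using zero[of x] by (simp add: P_def)
  have orth: "partial_deriv i u x \<bullet> u x = 0" for i x
  proof -
    \<comment> \<open>When \<open>P 1\<close> vanishes, \<open>G 1\<close> reduces to twice the sum
      of the squares of \<open>partial_deriv i u x \<bullet> u x\<close>, so this sign forces every
      term to be zero.\<close>
    have "G 1 x \<le> 0"
      by (rule visc_sub_zero[OF visc_sub_P]) (use zero in auto)
    then have "(\<Sum>i\<in>UNIV. (partial_deriv i u x \<bullet> u x)\<^sup>2) \<le> 0"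
      using G_ge[of x 1] zero[of x] by simp
    then have "(\<Sum>i\<in>UNIV. (partial_deriv i u x \<bullet> u x)\<^sup>2) = 0"
      by (intro antisym sum_nonneg) auto
    then show ?thesis by (simp add: sum_nonneg_eq_0_iff)
  qed
  have "(\<lambda>x. u x \<bullet> u x) constant_on UNIV"
  proof (rule constant_on_partial_deriv_zero)
    fix x
    obtain u' where u': "(u has_derivative u') (at x)"
      using C1 unfolding C1_fun_def differentiable_def by blast
    note der = has_derivative_inner[OF u' u']
    then show "(\<lambda>x. u x \<bullet> u x) differentiable (at x)"
      unfolding differentiable_def by blast
    fix i
    show "partial_deriv i (\<lambda>x. u x \<bullet> u x) x = 0"
      using partial_deriv_eq[OF der] orth[of i x] partial_deriv_eq[OF u'] by (simp add: inner_commute)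
  qed
  then obtain c where c: "\<And>x. (norm (u x))\<^sup>2 = c"
    by (auto simp: constant_on_def power2_norm_eq_inner)
  \<comment> \<open>Every point is both a maximum and a minimum of a constant function, so the
    second derivative test for it and its negative fixes \<open>L\<close>.\<close>
  have lap0: "L = 0" if "has_grad_lap (\<lambda>x. (norm (u x))\<^sup>2) x D L" for x D L
  proof (rule antisym)
    show "L \<le> 0"
      by (rule has_grad_lap_max_nonpos[OF that, of UNIV]) (simp_all add: c)
    have "- 1 * L \<le> 0"
      by (rule has_grad_lap_max_nonpos[OF has_grad_lap_cmult[OF that], of UNIV]) (simp_all add: c)
    then show "0 \<le> L" by simp
  qed
  have "2 * grad_norm_sq u x - 2 * (norm (u x))\<^sup>2 * (1 - (norm (u x))\<^sup>2) = 0" for x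
    by (rule lap0[OF jet_norm_sq])
  \<comment> \<open>Inserting \<open>grad_norm_sq u x = 1 - c\<close> into the Laplacian of the
    squared norm leaves \<open>2 * (1 - c)\<^sup>2\<close>.\<close>
  then have "2 * (1 - c) - 2 * c * (1 - c) = 0"
    by (simp add: grad c)
  then have "(1 - c)\<^sup>2 = 0"
    by (simp add: power2_eq_square algebra_simps)
  then have "grad_norm_sq u x = 0" for x
    by (simp add: grad c)
  then have "partial_deriv i u x = 0" for i x
    unfolding grad_norm_sq_def by (simp add: sum_nonneg_eq_0_iff)
  moreover have "u differentiable (at x)" for x
    using C1 by (simp add: C1_fun_def)
  ultimately show ?thesis
    by (intro constant_on_partial_deriv_zero)
qed

lemma P_neg:
  assumes "\<not> u constant_on UNIV"
  shows "P 1 x < 0"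
proof (rule ccontr)
  assume "\<not> P 1 x < 0"
  then have x: "P 1 x = 0" using P_nonpos[of x] by simp
  have "P 1 y = 0" for y
  proof (rule visc_sub_strong_max[OF visc_sub_P _ P_nonpos _ x])
    show "continuous_on UNIV (P 1)"
      unfolding P_def grad_norm_sq_def
      by (intro continuous_intros cont C1_fun_continuous_partial_deriv C1)
    show "2 * P 1 x \<le> G 1 x" for x
    proof -
      \<comment> \<open>Multiplying the nonpositive \<open>P 1\<close> by a factor at most 1 can
        only raise it, so \<open>2 * (norm (u x))\<^sup>2 * P 1 x \<ge> 2 * P 1 x\<close>.\<close>
      have "1 * P 1 x \<le> (norm (u x))\<^sup>2 * P 1 x"
        using norm_sq_le_1 P_nonpos by (intro mult_right_mono_neg)
      moreover have "0 \<le> (\<Sum>i\<in>UNIV. (partial_deriv i u x \<bullet> u x)\<^sup>2)"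
        by (simp add: sum_nonneg)
      ultimately show ?thesis
        using G_ge[of x 1] by simp
    qed
  qed simp
  then show False using P_zero_imp_constant assms by blast
qed

end

theorem theorem3p3:
  fixes u :: "real ^ 'n::finite \<Rightarrow> real ^ 'm::finite"
  assumes "C2_fun u"
    and "\<not> u constant_on UNIV"
    and "\<And>x. vec_laplacian u x = ((norm (u x))\<^sup>2 - 1) *\<^sub>R u x"
  shows "\<forall>x. norm (u x) < 1
           \<and> 1/2 * grad_norm_sq u x < sqrt (GL_potential (u x))
           \<and> sqrt (GL_potential (u x)) = 1/2 * (1 - (norm (u x))\<^sup>2)"
proof
  fix x
  interpret ginzburg_landau u
    using assms by unfold_locales auto
  have neg: "grad_norm_sq u x < 1 - (norm (u x))\<^sup>2"
    using P_neg[OF assms(2), of x] by (simp add: P_def)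
  \<comment> \<open>Strictness of the norm bound comes from the gradient estimate, as the squared
    gradient is nonnegative; it also fixes the sign when taking the square root of the
    potential.\<close>
  then have less: "(norm (u x))\<^sup>2 < 1"
    using grad_norm_sq_nonneg[of x] by simp
  have "GL_potential (u x) = (1/2 * (1 - (norm (u x))\<^sup>2))\<^sup>2"
    unfolding GL_potential_def power_mult_distrib power2_commute[of 1] by (simp add: power_divide)
  then have "sqrt (GL_potential (u x)) = 1/2 * (1 - (norm (u x))\<^sup>2)"
    using less by simp
  then show "norm (u x) < 1 \<and> 1/2 * grad_norm_sq u x < sqrt (GL_potential (u x))
      \<and> sqrt (GL_potential (u x)) = 1/2 * (1 - (norm (u x))\<^sup>2)"
    using neg less by (simp add: power_less_one_iff abs_square_less_1)
qed

end
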